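(* Let $n>3$ be a positive odd integer. Then \[ \sum_{k=0}^{(n+1)/2}[4k+1]\frac{(q^{-1};q^2)_k^2\, (q;q^2)_k^2} {(q^4;q^2)_k^2\, (q^2;q^2)_k^2}\, q^{4k} \equiv 0 \pmod{[n]\Phi_n(q)^2}. \]
   Context: Here $q$ is an indeterminate. For $x$ and a base $p$ (a power of $q$), $(x;p)_k=\prod_{j=0}^{k-1}(1-xp^j)$ for integers $k\ge0$. The $q$-integer is $[j]=1+q+\cdots+q^{j-1}$, and $\Phi_n(q)$ is the $n$-th cyclotomic polynomial. For rational functions $A(q),B(q)$ and a polynomial $P(q)$, $A\equiv B\pmod{P}$ means that the numerator of the reduced form of $A-B$ is divisible by $P$ in $\mathbb{Z}[q]$. *)

theory Defs
  imports
    "HOL-Computational_Algebra.Computational_Algebra"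
begin

text \<open>
  The indeterminate \<open>q\<close> as an element of the field of rational functions; the fraction field of
  \<open>int poly\<close> is used because it carries reduced forms over \<open>\<int>[q]\<close>.
\<close>

definition qvar :: "int poly fract" where
  "qvar = to_fract [:0, 1:]"

definition qpoch :: "'a::comm_ring_1 \<Rightarrow> 'a \<Rightarrow> nat \<Rightarrow> 'a" where
  "qpoch x p k = (\<Prod>j<k. 1 - x * p ^ j)"

text \<open>
  Stated for an arbitrary base, so that \<open>[n]\<close> is available both as a rational function
  (base \<^term>\<open>qvar\<close>) and as a polynomial (base \<open>[:0, 1:]\<close>).
\<close>

definition qint :: "'a::comm_semiring_1 \<Rightarrow> nat \<Rightarrow> 'a" where
  "qint x n = (\<Sum>j<n. x ^ j)"

text \<open>
  \<^const>\<open>quot_of_fract\<close> gives the coprime numerator and denominator over \<open>\<int>[q]\<close>. Coprimality is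
  that of \<open>\<int>[q]\<close>, so common integer factors are cancelled as well.
\<close>

definition ratfun_cong :: "int poly fract \<Rightarrow> int poly fract \<Rightarrow> int poly \<Rightarrow> bool" where
  "ratfun_cong A B P \<longleftrightarrow> P dvd fst (quot_of_fract (A - B))"

definition primitive_roots_unity :: "nat \<Rightarrow> complex set" where
  "primitive_roots_unity n = {z. z ^ n = 1 \<and> (\<forall>m\<in>{1..<n}. z ^ m \<noteq> 1)}"

definition complex_cyclotomic :: "nat \<Rightarrow> complex poly" where
  "complex_cyclotomic n = (\<Prod>z\<in>primitive_roots_unity n. [:- z, 1:])"

text \<open>
  The integer polynomial is described by its image in \<open>\<complex>[q]\<close>; existence is
  \<open>of_int_poly_cyclotomic\<close> below. For \<open>n = 0\<close> the value is irrelevant.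
\<close>

definition cyclotomic :: "nat \<Rightarrow> int poly" where
  "cyclotomic n = (THE p. map_poly of_int p = complex_cyclotomic n)"

lemma finite_primitive_roots_unity: "n > 0 \<Longrightarrow> finite (primitive_roots_unity n)"
  by (rule finite_subset[OF _ finite_roots_unity[of n]]) (auto simp: primitive_roots_unity_def)

lemma roots_unity_partition:
  assumes "n > 0"
  shows "{z::complex. z ^ n = 1} = (\<Union>d\<in>{d. d dvd n}. primitive_roots_unity d)"
proof (intro equalityI subsetI)
  fix z :: complex assume "z \<in> {z. z ^ n = 1}"
  hence z: "z ^ n = 1" by simp
  define d where "d = (LEAST d. d > 0 \<and> z ^ d = 1)"
  have d: "d > 0" "z ^ d = 1"
    using LeastI[of "\<lambda>d. d > 0 \<and> z ^ d = 1" n] assms z by (auto simp: d_def)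
  have least: "\<not> (m > 0 \<and> z ^ m = 1)" if "m < d" for m
    using not_less_Least[of m "\<lambda>d. d > 0 \<and> z ^ d = 1"] that by (simp add: d_def)
  have "z ^ n = z ^ (d * (n div d) + n mod d)" by simp
  also have "\<dots> = z ^ (n mod d)"
    by (simp only: power_add power_mult d power_one mult_1_left)
  finally have "z ^ (n mod d) = 1" using z by simp
  with least[of "n mod d"] d have "n mod d = 0" by auto
  hence "d dvd n" by auto
  moreover have "z \<in> primitive_roots_unity d"
    using d least unfolding primitive_roots_unity_def by force
  ultimately show "z \<in> (\<Union>d\<in>{d. d dvd n}. primitive_roots_unity d)" by blast
next
  fix z assume "z \<in> (\<Union>d\<in>{d. d dvd n}. primitive_roots_unity d)"
  then obtain d where "d dvd n" "z ^ d = 1"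
    by (auto simp: primitive_roots_unity_def)
  thus "z \<in> {z. z ^ n = 1}" by (auto simp: power_mult elim!: dvdE)
qed

lemma primitive_roots_unity_disjoint:
  assumes "d > 0" "e > 0" "d \<noteq> e"
  shows "primitive_roots_unity d \<inter> primitive_roots_unity e = {}"
  using assms by (cases d e rule: linorder_cases) (auto simp: primitive_roots_unity_def)

lemma monic_prod_linear:
  "finite A \<Longrightarrow> lead_coeff (\<Prod>z\<in>A. [:- z, 1:]) = (1::complex)"
  by (simp add: lead_coeff_prod)

lemma degree_prod_linear:
  "finite A \<Longrightarrow> degree (\<Prod>z\<in>A. [:- z, 1:]) = card (A :: complex set)"
  by (subst degree_prod_eq_sum_degree) auto

lemma unity_poly_eq_prod_linear:
  assumes "n > 0"
  shows "monom 1 n - 1 = (\<Prod>z\<in>{z. z ^ n = 1}. [:- z, 1:] :: complex poly)" (is "?l = ?r")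
proof (rule ccontr)
  assume ne: "?l \<noteq> ?r"
  let ?R = "{z::complex. z ^ n = 1}"
  have fin: "finite ?R" using assms by (intro finite_roots_unity) simp
  have card: "card ?R = n" using assms by (rule card_roots_unity_eq)
  have degr: "degree ?r = n" using degree_prod_linear[OF fin] card by simp
  have lcr: "coeff ?r n = 1" using monic_prod_linear[OF fin] degr by simp
  have "degree (monom (1::complex) n) \<le> n" by (rule degree_monom_le)
  hence degl: "degree ?l \<le> n" by (intro degree_diff_le) auto
  have lcl: "coeff ?l n = 1" using assms by simp
  have "degree (?l - ?r) \<le> n" using degree_diff_le[OF degl, of ?r] degr by simp
  moreover have "coeff (?l - ?r) n = 0" using lcl lcr by simp
  moreover have "?l - ?r \<noteq> 0" using ne by simp
  ultimately have "degree (?l - ?r) < n"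
    by (metis leading_coeff_0_iff le_neq_implies_less)
  moreover have "?R \<subseteq> {z. poly (?l - ?r) z = 0}"
    using fin by (auto simp: poly_monom poly_prod prod_zero_iff)
  hence "n \<le> card {z. poly (?l - ?r) z = 0}"
    using card card_mono[OF poly_roots_finite[OF \<open>?l - ?r \<noteq> 0\<close>]] by metis
  moreover have "card {z. poly (?l - ?r) z = 0} \<le> degree (?l - ?r)"
    using \<open>?l - ?r \<noteq> 0\<close> by (rule card_poly_roots_bound)
  ultimately show False by simp
qed

lemma prod_complex_cyclotomic:
  assumes "n > 0"
  shows "(\<Prod>d\<in>{d. d dvd n}. complex_cyclotomic d) = monom 1 n - 1"
proof -
  have pos: "d > 0" if "d dvd n" for d using that assms by (auto intro: Nat.gr0I)
  have "monom 1 n - 1 = (\<Prod>z\<in>(\<Union>d\<in>{d. d dvd n}. primitive_roots_unity d). [:- z, 1:])"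
    using unity_poly_eq_prod_linear[OF assms] roots_unity_partition[OF assms] by simp
  also have "\<dots> = (\<Prod>d\<in>{d. d dvd n}. complex_cyclotomic d)"
    unfolding complex_cyclotomic_def using assms pos
    by (intro prod.UNION_disjoint ballI impI)
       (auto intro: finite_primitive_roots_unity dest: primitive_roots_unity_disjoint)
  finally show ?thesis ..
qed

lemma map_poly_of_int_add:
  "map_poly of_int (p + r) = (map_poly of_int p + map_poly of_int r :: complex poly)"
  by (rule poly_eqI) (simp add: coeff_map_poly)

lemma map_poly_of_int_mult:
  "map_poly of_int (p * r) = (map_poly of_int p * map_poly of_int r :: complex poly)"
  by (rule poly_eqI) (simp add: coeff_map_poly coeff_mult)

lemma map_poly_of_int_prod:
  "map_poly of_int (prod f A) = (\<Prod>x\<in>A. map_poly of_int (f x) :: complex poly)"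
  by (induction A rule: infinite_finite_induct) (simp_all add: map_poly_of_int_mult)

lemma map_poly_of_int_inject:
  "map_poly of_int p = (map_poly of_int r :: complex poly) \<Longrightarrow> p = r"
  by (simp add: poly_eq_iff coeff_map_poly)

lemma degree_map_poly_of_int: "degree (map_poly of_int p :: complex poly) = degree p"
  by (rule degree_map_poly) simp

lemma ex_int_cyclotomic:
  "n > 0 \<Longrightarrow> \<exists>p::int poly. map_poly of_int p = complex_cyclotomic n"
proof (induction n rule: less_induct)
  case (less n)
  let ?D = "{d. d dvd n \<and> d \<noteq> n}"
  have "\<forall>d\<in>?D. \<exists>p::int poly. map_poly of_int p = complex_cyclotomic d"
    using less by (auto dest: dvd_imp_le intro!: less.IH Nat.gr0I)
  then obtain f :: "nat \<Rightarrow> int poly"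
    where f: "\<And>d. d \<in> ?D \<Longrightarrow> map_poly of_int (f d) = complex_cyclotomic d"
    by metis
  define Q where "Q = prod f ?D"
  define C :: "complex poly" where "C = map_poly of_int Q"
  have C: "C = (\<Prod>d\<in>?D. complex_cyclotomic d)"
    unfolding C_def Q_def map_poly_of_int_prod by (rule prod.cong) (auto simp: f)
  have pos: "d > 0" if "d dvd n" for d using that less.prems by (auto intro: Nat.gr0I)
  have "lead_coeff C = 1"
    unfolding C lead_coeff_prod complex_cyclotomic_def
    using pos by (intro prod.neutral ballI monic_prod_linear finite_primitive_roots_unity) auto
  hence lcQ: "lead_coeff Q = 1"
    by (simp add: C_def degree_map_poly_of_int coeff_map_poly)
  hence "Q \<noteq> 0" by auto
  obtain s r where sr: "pseudo_divmod (monom 1 n - 1) Q = (s, r)" by force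
  have eq: "monom 1 n - 1 = Q * s + r"
    using pseudo_divmod(1)[OF \<open>Q \<noteq> 0\<close> sr] lcQ by simp
  have deg: "r = 0 \<or> degree r < degree Q"
    using pseudo_divmod(2)[OF \<open>Q \<noteq> 0\<close> sr] .
  have "{d. d dvd n} = insert n ?D" by auto
  moreover have "finite ?D" using less.prems by simp
  ultimately have "(\<Prod>d\<in>{d. d dvd n}. complex_cyclotomic d) = complex_cyclotomic n * C"
    by (simp add: C)
  hence "monom 1 n - 1 = complex_cyclotomic n * C"
    by (simp add: prod_complex_cyclotomic[OF less.prems])
  moreover have "monom 1 n - 1 = (map_poly of_int (monom 1 n - 1 :: int poly) :: complex poly)"
    by (rule poly_eqI) (auto simp: coeff_map_poly)
  ultimately have "complex_cyclotomic n * C = C * map_poly of_int s + map_poly of_int r"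
    unfolding eq map_poly_of_int_add map_poly_of_int_mult C_def by simp
  hence *: "C * (complex_cyclotomic n - map_poly of_int s) = map_poly of_int r"
    by (simp add: algebra_simps)
  have "complex_cyclotomic n - map_poly of_int s = 0"
  proof (rule ccontr)
    assume ne: "complex_cyclotomic n - map_poly of_int s \<noteq> 0"
    have "C \<noteq> 0" using \<open>lead_coeff C = 1\<close> by auto
    hence "C * (complex_cyclotomic n - map_poly of_int s) \<noteq> 0" using ne by simp
    hence "r \<noteq> 0" using * by auto
    moreover have "degree Q \<le> degree r"
      using degree_mult_right_le[OF ne, of C] ne \<open>C \<noteq> 0\<close> arg_cong[OF *, of degree]
      by (simp add: degree_mult_eq degree_map_poly_of_int C_def)
    ultimately show False using deg by simp
  qed
  thus ?case by (intro exI[of _ s]) simp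
qed

lemma of_int_poly_cyclotomic:
  assumes "n > 0"
  shows "map_poly of_int (cyclotomic n) = complex_cyclotomic n"
  unfolding cyclotomic_def
  by (rule theI') (use ex_int_cyclotomic[OF assms] map_poly_of_int_inject in metis)

end

theory Submission
  imports Defs
begin

text \<open>
  The modulus is monic, so it suffices to bound below the order of vanishing of the numerator at
  every \<open>n\<close>-th root of unity \<open>w \<noteq> 1\<close>: three if \<open>w\<close> is primitive, and one otherwise.

  For primitive \<open>w\<close> the factors \<open>(1 - q\<^sup>i)\<^sup>2\<close> of \<open>(q\<^sup>-\<^sup>1;q\<^sup>2)\<^sub>k\<^sup>2\<close> and \<open>(q\<^sup>4;q\<^sup>2)\<^sub>k\<^sup>2\<close> are deformed to
  \<open>(1 - a q\<^sup>i) (1 - q\<^sup>i / a) = (1 - q\<^sup>i)\<^sup>2 - t q\<^sup>i\<close> with \<open>t = a + 1/a - 2\<close>. At \<open>q = w\<close> the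
  deformed sum vanishes for all \<open>t\<close>, since its terms cancel in pairs \<open>k\<close>, \<open>(n-1)/2 - k\<close>. At
  \<open>a = q\<^sup>n\<close>, that is \<open>t = (1 - q\<^sup>n)\<^sup>2 / q\<^sup>n\<close>, it vanishes identically in \<open>q\<close>, because it is a divided
  difference of order \<open>(n+1)/2\<close> of a polynomial of degree \<open>(n-3)/2\<close> on the quadratic
  lattice \<open>q\<^sup>-\<^sup>2\<^sup>k + q\<^sup>2\<^sup>k\<^sup>+\<^sup>1\<close>. Together this gives a zero of order three at \<open>t = 0\<close>.

  For \<open>w\<close> of order \<open>d < n\<close> the terms have limits as \<open>q\<close> tends to \<open>w\<close>, and these limits
  split into blocks of length \<open>d\<close>, each proportional to the vanishing half sum for \<open>d\<close>.
\<close>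

subsection \<open>Numerators of rational functions over the complex numbers\<close>

abbreviation cpoly :: "int poly \<Rightarrow> complex poly" where
  "cpoly \<equiv> map_poly of_int"

lemma cpoly_eq_0_iff: "cpoly p = 0 \<longleftrightarrow> p = 0"
  by (simp add: poly_eq_iff coeff_map_poly)

lemma eventually_poly_neq_0:
  fixes p :: "complex poly"
  assumes "p \<noteq> 0"
  shows "\<forall>\<^sub>F z in cofinite. poly p z \<noteq> 0"
  using poly_roots_finite[OF assms] by (simp add: eventually_cofinite)

lemma poly_eqI_cofinite:
  fixes p r :: "complex poly"
  assumes "\<forall>\<^sub>F z in cofinite. poly p z = poly r z"
  shows "p = r"
proof (rule ccontr)
  assume "p \<noteq> r"
  hence "p - r \<noteq> 0" by simp
  from eventually_poly_neq_0[OF this] assms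
  have "\<forall>\<^sub>F z :: complex in cofinite. False" by eventually_elim simp
  hence "finite (UNIV :: complex set)" by (simp add: eventually_cofinite)
  thus False using infinite_UNIV_char_0 by blast
qed

text \<open>Division by a monic polynomial stays over the integers. The remainder is divisible by
  \<open>P\<close> over the complex numbers but has smaller degree, so it is zero.\<close>

lemma monic_dvd_if_cpoly_dvd:
  assumes "lead_coeff P = 1" and "cpoly P dvd cpoly p"
  shows "P dvd p"
proof -
  have P0: "P \<noteq> 0" using assms(1) by auto
  obtain s r where sr: "pseudo_divmod p P = (s, r)" by force
  have eq: "p = P * s + r"
    using pseudo_divmod(1)[OF P0 sr] assms(1) by simp
  have "cpoly P dvd cpoly r"
    using assms(2) unfolding eq map_poly_of_int_add map_poly_of_int_mult
    by (simp add: dvd_add_right_iff)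
  hence "r = 0 \<or> degree P \<le> degree r"
    using dvd_imp_degree_le[of "cpoly P" "cpoly r"]
    by (auto simp: degree_map_poly_of_int cpoly_eq_0_iff)
  hence "r = 0" using pseudo_divmod(2)[OF P0 sr] by auto
  thus ?thesis using eq by simp
qed

text \<open>
  Exceptions on a finite set absorb the poles as well as the junk value of division by zero, so
  the relation is compatible with all field operations without side conditions.
\<close>

definition represents :: "int poly fract \<Rightarrow> (complex \<Rightarrow> complex) \<Rightarrow> bool" where
  "represents x f \<longleftrightarrow> (\<exists>a b. b \<noteq> 0 \<and> x = Fract a b \<and>
     (\<forall>\<^sub>F z in cofinite. f z = poly (cpoly a) z / poly (cpoly b) z))"

lemma representsI:
  assumes "b \<noteq> 0" "x = Fract a b"
    "\<forall>\<^sub>F z in cofinite. f z = poly (cpoly a) z / poly (cpoly b) z"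
  shows "represents x f"
  using assms unfolding represents_def by blast

lemma eventually_cpoly_neq_0: "p \<noteq> 0 \<Longrightarrow> \<forall>\<^sub>F z in cofinite. poly (cpoly p) z \<noteq> 0"
  by (rule eventually_poly_neq_0) (simp add: cpoly_eq_0_iff)

lemma represents_0: "represents 0 (\<lambda>_. 0)"
  by (rule representsI[of 1 _ 0]) (auto simp: Zero_fract_def)

lemma represents_1: "represents 1 (\<lambda>_. 1)"
  by (rule representsI[of 1 _ 1]) (auto simp: One_fract_def map_poly_1)

lemma represents_qvar: "represents qvar (\<lambda>z. z)"
  by (rule representsI[of 1 _ "[:0, 1:]"]) (auto simp: qvar_def to_fract_def map_poly_pCons)

lemma represents_add:
  assumes "represents x f" "represents y g"
  shows "represents (x + y) (\<lambda>z. f z + g z)"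
proof -
  obtain a b c d where 1: "b \<noteq> 0" "x = Fract a b" "d \<noteq> 0" "y = Fract c d"
    and f: "\<forall>\<^sub>F z in cofinite. f z = poly (cpoly a) z / poly (cpoly b) z"
    and g: "\<forall>\<^sub>F z in cofinite. g z = poly (cpoly c) z / poly (cpoly d) z"
    using assms unfolding represents_def by blast
  show ?thesis
  proof (rule representsI[of "b * d" _ "a * d + c * b"])
    show "\<forall>\<^sub>F z in cofinite. f z + g z = poly (cpoly (a * d + c * b)) z / poly (cpoly (b * d)) z"
      using f g eventually_cpoly_neq_0[OF 1(1)] eventually_cpoly_neq_0[OF 1(3)]
      by eventually_elim (simp add: map_poly_of_int_mult map_poly_of_int_add add_frac_eq)
  qed (use 1 in auto)
qed

lemma represents_mult:
  assumes "represents x f" "represents y g"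
  shows "represents (x * y) (\<lambda>z. f z * g z)"
proof -
  obtain a b c d where 1: "b \<noteq> 0" "x = Fract a b" "d \<noteq> 0" "y = Fract c d"
    and f: "\<forall>\<^sub>F z in cofinite. f z = poly (cpoly a) z / poly (cpoly b) z"
    and g: "\<forall>\<^sub>F z in cofinite. g z = poly (cpoly c) z / poly (cpoly d) z"
    using assms unfolding represents_def by blast
  show ?thesis
  proof (rule representsI[of "b * d" _ "a * c"])
    show "\<forall>\<^sub>F z in cofinite. f z * g z = poly (cpoly (a * c)) z / poly (cpoly (b * d)) z"
      using f g by eventually_elim (simp add: map_poly_of_int_mult)
  qed (use 1 in auto)
qed

lemma represents_uminus:
  assumes "represents x f"
  shows "represents (- x) (\<lambda>z. - f z)"
proof -
  obtain a b where 1: "b \<noteq> 0" "x = Fract a b"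
    and f: "\<forall>\<^sub>F z in cofinite. f z = poly (cpoly a) z / poly (cpoly b) z"
    using assms unfolding represents_def by blast
  show ?thesis
  proof (rule representsI[of b _ "- a"])
    have neg: "cpoly (- a) = - cpoly a" by (rule poly_eqI) (simp add: coeff_map_poly)
    show "\<forall>\<^sub>F z in cofinite. - f z = poly (cpoly (- a)) z / poly (cpoly b) z"
      using f by eventually_elim (simp add: neg)
  qed (use 1 in auto)
qed

lemma represents_inverse:
  assumes "represents x f"
  shows "represents (inverse x) (\<lambda>z. inverse (f z))"
proof -
  obtain a b where 1: "b \<noteq> 0" "x = Fract a b"
    and f: "\<forall>\<^sub>F z in cofinite. f z = poly (cpoly a) z / poly (cpoly b) z"
    using assms unfolding represents_def by blast
  show ?thesis
  \<comment> \<open>The zero fraction has no reciprocal fraction, but \<open>inverse 0 = 0\<close>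
    holds in both fields.\<close>
  proof (cases "a = 0")
    case True
    have "\<forall>\<^sub>F z in cofinite. inverse (f z) = 0" using f by eventually_elim (simp add: True)
    thus ?thesis using 1 True
      by (intro representsI[of 1 _ 0]) (auto simp: fract_collapse)
  next
    case False
    have "\<forall>\<^sub>F z in cofinite. inverse (f z) = poly (cpoly b) z / poly (cpoly a) z"
      using f by eventually_elim simp
    thus ?thesis using 1 False by (intro representsI[of a _ b]) auto
  qed
qed

lemma represents_diff:
  "represents x f \<Longrightarrow> represents y g \<Longrightarrow> represents (x - y) (\<lambda>z. f z - g z)"
  using represents_add[OF _ represents_uminus, of x f y g] by simp

lemma represents_divide:
  "represents x f \<Longrightarrow> represents y g \<Longrightarrow> represents (x / y) (\<lambda>z. f z / g z)"
  using represents_mult[OF _ represents_inverse, of x f y g] by (simp add: divide_inverse)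

lemma represents_power: "represents x f \<Longrightarrow> represents (x ^ k) (\<lambda>z. f z ^ k)"
  by (induction k) (auto intro: represents_1 represents_mult)

lemma represents_sum:
  "(\<And>i. i \<in> I \<Longrightarrow> represents (x i) (f i)) \<Longrightarrow> represents (sum x I) (\<lambda>z. \<Sum>i\<in>I. f i z)"
  by (induction I rule: infinite_finite_induct) (auto intro: represents_0 represents_add)

lemma represents_prod:
  "(\<And>i. i \<in> I \<Longrightarrow> represents (x i) (f i)) \<Longrightarrow> represents (prod x I) (\<lambda>z. \<Prod>i\<in>I. f i z)"
  by (induction I rule: infinite_finite_induct) (auto intro: represents_1 represents_mult)

lemma represents_qint: "represents x f \<Longrightarrow> represents (qint x k) (\<lambda>z. qint (f z) k)"
  unfolding qint_def by (intro represents_sum represents_power)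

lemma represents_qpoch:
  "represents x f \<Longrightarrow> represents y g \<Longrightarrow> represents (qpoch x y k) (\<lambda>z. qpoch (f z) (g z) k)"
  unfolding qpoch_def
  by (intro represents_prod represents_diff represents_mult represents_power represents_1)

text \<open>Cross-multiplying the reduced form with a representing fraction and cancelling
  \<open>b\<close> ties the numerator in \<open>ratfun_cong\<close> to the values of
  \<open>f\<close>.\<close>

lemma represents_quot_of_fract:
  assumes "represents x f"
  shows "\<forall>\<^sub>F z in cofinite.
    poly (cpoly (fst (quot_of_fract x))) z = f z * poly (cpoly (snd (quot_of_fract x))) z"
proof -
  obtain a b where 1: "b \<noteq> 0" "x = Fract a b"
    and f: "\<forall>\<^sub>F z in cofinite. f z = poly (cpoly a) z / poly (cpoly b) z"
    using assms unfolding represents_def by blast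
  have "Fract (fst (quot_of_fract x)) (snd (quot_of_fract x)) = Fract a b"
    using 1 by simp
  hence "fst (quot_of_fract x) * b = a * snd (quot_of_fract x)"
    using 1 by (subst (asm) eq_fract(1)) auto
  hence "cpoly (fst (quot_of_fract x)) * cpoly b = cpoly a * cpoly (snd (quot_of_fract x))"
    by (metis map_poly_of_int_mult)
  hence *: "poly (cpoly (fst (quot_of_fract x))) z * poly (cpoly b) z =
      poly (cpoly a) z * poly (cpoly (snd (quot_of_fract x))) z" for z
    by (metis poly_mult)
  show ?thesis
    using f eventually_cpoly_neq_0[OF 1(1)]
  proof eventually_elim
    case (elim z)
    have "poly (cpoly (fst (quot_of_fract x))) z * poly (cpoly b) z =
        f z * poly (cpoly (snd (quot_of_fract x))) z * poly (cpoly b) z"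
      unfolding * using elim by simp
    thus ?case using elim(2) by simp
  qed
qed

text \<open>The product over \<open>A\<close> does not vanish at a further point \<open>w\<close>,
  so the whole order of \<open>p\<close> at \<open>w\<close> is carried by the cofactor.\<close>

lemma prod_linear_power_dvd:
  fixes p :: "complex poly"
  assumes "finite A" and "\<And>z. z \<in> A \<Longrightarrow> [:-z, 1:] ^ m z dvd p"
  shows "(\<Prod>z\<in>A. [:-z, 1:] ^ m z) dvd p"
proof (cases "p = 0")
  case False
  show ?thesis using assms
  proof (induction A rule: finite_induct)
    case (insert w A)
    let ?B = "\<Prod>z\<in>A. [:-z, 1:] ^ m z"
    obtain r where r: "p = ?B * r" using insert by (auto elim: dvdE)
    have "poly ?B w \<noteq> 0" using insert.hyps by (auto simp: poly_prod)
    hence "order w ?B = 0" by (rule order_0I)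
    moreover have "m w \<le> order w p" 
      using insert.prems[of w] False by (auto simp: order_divides)
    moreover have "order w p = order w ?B + order w r" 
      using r False by (metis order_mult)
    ultimately have "[:-w, 1:] ^ m w dvd r" using order_divides by auto
    hence "?B * [:-w, 1:] ^ m w dvd ?B * r" by (rule mult_dvd_mono[OF dvd_refl])
    thus ?case using insert.hyps r by (simp add: mult.commute)
  qed simp
qed simp

lemma linear_power_dvd_cancel:
  fixes p r :: "complex poly"
  assumes "[:-w, 1:] ^ m dvd p * r" and "poly r w \<noteq> 0"
  shows "[:-w, 1:] ^ m dvd p"
proof (cases "p = 0")
  case False
  hence "p * r \<noteq> 0" using assms(2) by auto
  thus ?thesis using assms False order_mult[of p r w] order_0I[of r w]
    by (auto simp: order_divides)
qed simp

subsection \<open>The sum with an additional parameter\<close>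

text \<open>
  Numerator and denominator of the ratio of consecutive terms of the deformed sum. The parameter
  is \<open>s = t q\<^sup>n\<close>, and powers of \<open>q\<close> are multiplied in so that both are polynomials in \<open>q\<close> and \<open>s\<close>.
\<close>

definition vnum :: "'a::comm_ring_1 \<Rightarrow> nat \<Rightarrow> 'a \<Rightarrow> nat \<Rightarrow> 'a" where
  "vnum q n s j =
     q ^ 2 * (q ^ n * (q - q ^ (2 * j)) ^ 2 - s * q ^ (2 * j + 1)) * (1 - q ^ (2 * j + 1)) ^ 2"

definition vden :: "'a::comm_ring_1 \<Rightarrow> nat \<Rightarrow> 'a \<Rightarrow> nat \<Rightarrow> 'a" where
  "vden q n s j =
     (q ^ n * (1 - q ^ (2 * j + 4)) ^ 2 - s * q ^ (2 * j + 4)) * (1 - q ^ (2 * j + 2)) ^ 2"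

text \<open>A term without its \<open>q\<close>-integer, multiplied by the common denominator of all
  terms with \<open>k \<le> N\<close>. Free of division, the sum makes sense over polynomial rings,
  where \<open>poly_vsum\<close> specialises \<open>q\<close> and \<open>s\<close>.\<close>

definition vterm :: "'a::comm_ring_1 \<Rightarrow> nat \<Rightarrow> 'a \<Rightarrow> nat \<Rightarrow> nat \<Rightarrow> 'a" where
  "vterm q n s N k = (\<Prod>j<k. vnum q n s j) * (\<Prod>j\<in>{k..<N}. vden q n s j)"

definition vsum :: "'a::comm_ring_1 \<Rightarrow> nat \<Rightarrow> 'a \<Rightarrow> nat \<Rightarrow> 'a" where
  "vsum q n s N = (\<Sum>k\<le>N. qint q (4 * k + 1) * vterm q n s N k)"

lemma poly_vsum: "poly (vsum Q n S N) z = vsum (poly Q z) n (poly S z) N"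
  by (simp add: vsum_def vterm_def vnum_def vden_def qint_def poly_sum poly_prod)

section \<open>Vanishing of the deformed sum at roots of unity\<close>

lemma qint_geometric: "(1 - x) * qint x n = (1 - x ^ n :: 'a::comm_ring_1)"
  by (simp add: qint_def one_diff_power_eq)

lemma vsum_Suc:
  "vsum q n s (Suc N) = vsum q n s N * vden q n s N +
     qint q (4 * Suc N + 1) * (\<Prod>j<Suc N. vnum q n s j)"
proof -
  have "vterm q n s (Suc N) k = vterm q n s N k * vden q n s N" if "k \<le> N" for k
    using that by (simp add: vterm_def)
  thus ?thesis
    by (simp add: vsum_def sum_distrib_right mult.assoc) (simp add: vterm_def)
qed

text \<open>With \<open>x = w ^ (2 * i)\<close> and \<open>y = w ^ (2 * (m - Suc i))\<close> the
  exponents in \<open>y * x * w ^ 3\<close> add up to \<open>n\<close>, so \<open>y\<close> is the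
  inverse of \<open>x * w ^ 3\<close>; clearing it from the numerator leaves the
  denominator.\<close>

lemma vnum_reflect:
  fixes w s :: "'a::comm_ring_1"
  assumes "w ^ n = 1" "n = 2 * m + 1" "i < m"
  shows "vnum w n s (m - Suc i) * w ^ (8 * i + 8) = vden w n s i"
proof -
  define x y where "x = w ^ (2 * i)" and "y = w ^ (2 * (m - Suc i))"
  have "y * x * w ^ 3 = w ^ (2 * (m - Suc i) + 2 * i + 3)"
    by (simp add: x_def y_def power_add)
  also have "2 * (m - Suc i) + 2 * i + 3 = n" using assms by simp
  finally have xy: "y * x * w ^ 3 = 1" using assms by simp
  have 1: "w ^ (8 * i + 8) = x ^ 4 * w ^ 8"
    by (simp add: x_def power_mult [symmetric] power_add mult.commute)
  have 2: "(w - y) * (x * w ^ 3) = x * w ^ 4 - 1"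
    using xy by (simp add: algebra_simps eval_nat_numeral)
  have 3: "(1 - y * w) * (x * w ^ 2) = x * w ^ 2 - 1"
    using xy by (simp add: algebra_simps eval_nat_numeral)
  have "y * w * (x * w ^ 3) ^ 2 = (y * x * w ^ 3) * (x * w ^ 4)"
    by (simp add: algebra_simps eval_nat_numeral)
  hence 4: "y * w * (x * w ^ 3) ^ 2 = x * w ^ 4"
    using xy by simp
  define a b where "a = w - y" and "b = 1 - y * w"
  have v: "vnum w n s (m - Suc i) = w ^ 2 * (a ^ 2 - s * (y * w)) * b ^ 2"
    using assms(1) by (simp add: vnum_def a_def b_def y_def mult.commute)
  have "vnum w n s (m - Suc i) * w ^ (8 * i + 8) =
      ((a * (x * w ^ 3)) ^ 2 - s * (y * w * (x * w ^ 3) ^ 2)) * (b * (x * w ^ 2)) ^ 2"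
    unfolding 1 v by (simp add: algebra_simps eval_nat_numeral)
  also have "\<dots> = (((w - y) * (x * w ^ 3)) ^ 2 - s * (y * w * (x * w ^ 3) ^ 2)) * ((1 - y * w) * (x * w ^ 2)) ^ 2"
    by (simp only: a_def b_def)
  also have "\<dots> = vden w n s i"
    unfolding 2 3 4 vden_def power_add x_def [symmetric] assms(1)
    by (simp add: power2_commute[of 1])
  finally show ?thesis .
qed

text \<open>This is \<open>vnum_reflect\<close> read at the reflected index; the two powers of
  \<open>w\<close> combine to \<open>w ^ (n * 4) = 1\<close>.\<close>

lemma vden_reflect:
  fixes w s :: "'a::comm_ring_1"
  assumes "w ^ n = 1" "n = 2 * m + 1" "i < m"
  shows "vden w n s (m - Suc i) * w ^ (8 * i + 4) = vnum w n s i"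
proof -
  define j where "j = m - Suc i"
  have j: "j < m" "m - Suc j = i" using assms by (auto simp: j_def)
  have "vden w n s j * w ^ (8 * i + 4) = vnum w n s i * w ^ (8 * j + 8 + (8 * i + 4))"
    unfolding power_add[of w "8 * j + 8"] vnum_reflect[OF assms(1,2) j(1), of s, symmetric] j(2)
    by (simp only: mult.assoc)
  also have "8 * j + 8 + (8 * i + 4) = n * 4" using assms by (simp add: j_def)
  also have "w ^ (n * 4) = 1" using assms(1) by (simp add: power_mult)
  finally show ?thesis by (simp add: j_def)
qed

text \<open>Reflecting every factor exchanges the two products. The accumulated power
  \<open>E\<close> of \<open>w\<close> is the inverse of \<open>w ^ (4 * k + 1)\<close>, because
  \<open>4 * m * (m + 1) + 1 = n * n\<close>.\<close>

lemma vterm_reflect: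
  fixes w s :: "'a::comm_ring_1"
  assumes "w ^ n = 1" "n = 2 * m + 1" "k \<le> m"
  shows "vterm w n s m (m - k) = w ^ (4 * k + 1) * vterm w n s m k"
proof -
  define E where "E = (\<Prod>i\<in>{k..<m}. w ^ (8 * i + 8)) * (\<Prod>i<k. w ^ (8 * i + 4))"
  have "(\<Prod>j<m - k. vnum w n s j) = (\<Prod>i\<in>{k..<m}. vnum w n s (m - Suc i))"
    using assms(3)
    by (intro prod.reindex_bij_witness[of _ "\<lambda>i. m - Suc i" "\<lambda>i. m - Suc i"]) auto
  hence 1: "(\<Prod>j<m - k. vnum w n s j) * (\<Prod>i\<in>{k..<m}. w ^ (8 * i + 8)) =
      (\<Prod>i\<in>{k..<m}. vden w n s i)"
    by (simp only: prod.distrib [symmetric]) (intro prod.cong refl vnum_reflect assms(1,2), simp)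
  have "(\<Prod>j\<in>{m-k..<m}. vden w n s j) = (\<Prod>i<k. vden w n s (m - Suc i))"
    using assms(3)
    by (intro prod.reindex_bij_witness[of _ "\<lambda>i. m - Suc i" "\<lambda>i. m - Suc i"]) auto
  hence 2: "(\<Prod>j\<in>{m-k..<m}. vden w n s j) * (\<Prod>i<k. w ^ (8 * i + 4)) =
      (\<Prod>i<k. vnum w n s i)"
    using assms(3)
    by (simp only: prod.distrib [symmetric]) (intro prod.cong refl vden_reflect assms(1,2), simp)
  have "vterm w n s m (m - k) * E = 
     ((\<Prod>j<m - k. vnum w n s j) * (\<Prod>i\<in>{k..<m}. w ^ (8 * i + 8))) *
     ((\<Prod>j\<in>{m-k..<m}. vden w n s j) * (\<Prod>i<k. w ^ (8 * i + 4)))"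
    by (simp add: vterm_def E_def mult_ac)
  also have "\<dots> = vterm w n s m k" unfolding 1 2 by (simp add: vterm_def mult_ac)
  finally have tE: "vterm w n s m (m - k) * E = vterm w n s m k" .
  \<comment> \<open>The factor \<open>w ^ (4 * k)\<close> raises the exponents
    \<open>8 * i + 4\<close> to \<open>8 * i + 8\<close>, so that both parts of \<open>E\<close>
    join into one product over \<open>i < m\<close>.\<close>
  have "(\<Prod>i<k. w ^ (8 * i + 4)) * w ^ (4 * k) = (\<Prod>i<k. w ^ (8 * i + 8))"
    by (induction k) (simp_all add: power_add algebra_simps)
  moreover have "E * w ^ (4 * k) =
      ((\<Prod>i<k. w ^ (8 * i + 4)) * w ^ (4 * k)) * (\<Prod>i\<in>{k..<m}. w ^ (8 * i + 8))"
    by (simp add: E_def mult_ac)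
  ultimately have "E * w ^ (4 * k) =
      (\<Prod>i<k. w ^ (8 * i + 8)) * (\<Prod>i\<in>{k..<m}. w ^ (8 * i + 8))"
    by simp
  also have "\<dots> = (\<Prod>i<m. w ^ (8 * i + 8))"
    using assms(3) prod.atLeastLessThan_concat[of 0 k m] by (simp add: atLeast0LessThan)
  also have "\<dots> = w ^ (4 * m * (m + 1))"
    by (induction m) (simp_all add: power_add [symmetric] algebra_simps)
  finally have "E * w ^ (4 * k + 1) = w ^ (4 * m * (m + 1) + 1)"
    by (simp add: mult.left_commute[of E] )
  also have "4 * m * (m + 1) + 1 = n * n" using assms by (simp add: algebra_simps)
  also have "w ^ (n * n) = 1" using assms(1) by (simp add: power_mult)
  finally have E: "E * w ^ (4 * k + 1) = 1" .
  have "vterm w n s m (m - k) = vterm w n s m (m - k) * E * w ^ (4 * k + 1)"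
    using E by (simp add: mult.assoc)
  thus ?thesis unfolding tE by (simp add: mult.commute)
qed

text \<open>Since \<open>w ^ (4 * (m - k) + 1)\<close> and \<open>w ^ (4 * k + 1)\<close> are
  inverse to each other, the power of \<open>w\<close> in \<open>vterm_reflect\<close> turns
  \<open>[4(m-k)+1]\<close> into \<open>-[4k+1]\<close>.\<close>

lemma vsum_half_eq_0:
  fixes w s :: complex
  assumes "w ^ n = 1" "n = 2 * m + 1" "w \<noteq> 1"
  shows "vsum w n s m = 0"
proof -
  define t where "t k = qint w (4 * k + 1) * vterm w n s m k" for k
  have "t (m - k) = - t k" if "k \<le> m" for k
  proof -
    have "w ^ (4 * (m - k) + 1) * w ^ (4 * k + 1) = w ^ (n * 2)"
      unfolding power_add [symmetric] using assms(2) that by (intro arg_cong[of _ _ "\<lambda>i. w ^ i"]) simp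
    hence 1: "w ^ (4 * (m - k) + 1) * w ^ (4 * k + 1) = 1"
      using assms(1) by (simp only: power_mult power_one)
    have "(1 - w) * t (m - k) = (1 - w ^ (4 * (m - k) + 1)) * vterm w n s m (m - k)"
      unfolding t_def qint_geometric[symmetric] by (simp add: mult_ac)
    also have "\<dots> = (1 - w ^ (4 * (m - k) + 1)) * w ^ (4 * k + 1) * vterm w n s m k"
      unfolding vterm_reflect[OF assms(1,2) that] by (simp only: mult.assoc)
    also have "(1 - w ^ (4 * (m - k) + 1)) * w ^ (4 * k + 1) = - (1 - w ^ (4 * k + 1))"
      using 1 by (simp only: left_diff_distrib mult_1_left) simp
    also have "\<dots> * vterm w n s m k = (1 - w) * (- t k)"
      unfolding t_def qint_geometric[symmetric] by (simp add: mult_ac)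
    finally have "(1 - w) * t (m - k) = (1 - w) * (- t k)" .
    moreover have "1 - w \<noteq> 0" using assms(3) by simp
    ultimately show ?thesis by (metis mult_left_cancel)
  qed
  \<comment> \<open>The sum equals its own negative; this also covers a middle term, which is paired
    with itself.\<close>
  hence "(\<Sum>k\<le>m. t (m - k)) = - (\<Sum>k\<le>m. t k)"
    by (simp add: sum_negf [symmetric])
  moreover have "(\<Sum>k\<le>m. t (m - k)) = (\<Sum>k\<le>m. t k)"
    by (intro sum.reindex_bij_witness[of _ "\<lambda>k. m - k" "\<lambda>k. m - k"]) auto
  ultimately show ?thesis by (simp add: vsum_def t_def)
qed

text \<open>The additional term \<open>k = m + 1\<close> contains \<open>vnum w n s m\<close>, which
  has the factor \<open>1 - w ^ n\<close>.\<close>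

lemma vsum_eq_0_root_of_unity:
  fixes w s :: complex
  assumes "w ^ n = 1" "n = 2 * m + 1" "w \<noteq> 1"
  shows "vsum w n s (Suc m) = 0"
proof -
  have "vnum w n s m = 0" using assms(1,2) by (simp add: vnum_def)
  thus ?thesis using vsum_half_eq_0[OF assms] by (simp add: vsum_Suc)
qed

section \<open>The triple zero at \<open>s = 0\<close>\<close>

lemma continuous_poly_const:
  fixes M :: "complex poly poly"
  shows "isCont (\<lambda>c. poly (poly M [:c:]) w) a"
  by (induction M) (auto intro!: continuous_intros)

text \<open>
  As a polynomial in \<open>s\<close> the sum vanishes at \<open>s = (1 - q\<^sup>n)\<^sup>2\<close>, so at \<open>s = 0\<close> it is divisible by
  this square; the cofactor vanishes at \<open>q = w\<close> because there the sum is zero for all \<open>s\<close>.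
\<close>

lemma cube_dvd_vsum:
  fixes w :: complex
  assumes w: "w ^ n = 1" "n = 2 * m + 1" "w \<noteq> 1"
    and root: "\<forall>\<^sub>F z in cofinite. vsum z n ((1 - z ^ n) ^ 2) (Suc m) = (0 :: complex)"
  shows "[:-w, 1:] ^ 3 dvd vsum [:0, 1:] n 0 (Suc m)"
proof -
  define Q :: "complex poly" where "Q = [:0, 1:]"
  define s0 where "s0 = (1 - Q ^ n) ^ 2"
  \<comment> \<open>The outer variable of \<open>G\<close> is \<open>s\<close>, its coefficients are
    polynomials in \<open>q\<close>.\<close>
  define G :: "complex poly poly" where "G = vsum [:Q:] n [:0, 1:] (Suc m)"
  have G: "poly G S = vsum Q n S (Suc m)" for S
    by (simp add: G_def poly_vsum)
  have "poly G s0 = 0"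
    unfolding G
  proof (rule poly_eqI_cofinite)
    show "\<forall>\<^sub>F z in cofinite. poly (vsum Q n s0 (Suc m)) z = poly 0 z"
      using root by (simp add: poly_vsum Q_def s0_def)
  qed
  then obtain M where M: "G = [:-s0, 1:] * M"
    by (auto simp: poly_eq_0_iff_dvd)
  have s0w: "poly s0 w = 0" using w by (simp add: s0_def Q_def)
  \<comment> \<open>At \<open>q = w\<close> the linear factor \<open>s - s0\<close> takes the value
    \<open>c\<close>, so the vanishing passes to \<open>M\<close> for \<open>c \<noteq> 0\<close>;
    the value \<open>c = 0\<close> is reached by continuity.\<close>
  have "poly (poly M [:c:]) w = 0" if "c \<noteq> 0" for c
  proof -
    have "poly (poly G [:c:]) w = 0"
      using vsum_eq_0_root_of_unity[OF w] by (simp add: G poly_vsum Q_def)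
    thus ?thesis using that s0w by (simp add: M)
  qed
  hence "\<forall>\<^sub>F c in at 0. poly (poly M [:c:]) w = 0"
    by (auto simp: eventually_at_filter)
  hence "((\<lambda>c. poly (poly M [:c:]) w) \<longlongrightarrow> 0) (at 0)"
    by (rule tendsto_eventually)
  moreover have "((\<lambda>c. poly (poly M [:c:]) w) \<longlongrightarrow> poly (poly M [:0:]) w) (at 0)"
    using continuous_poly_const[where M = M and w = w and a = 0] by (simp add: isCont_def)
  ultimately have "poly (poly M [:0:]) w = 0"
    by (intro tendsto_unique[OF at_neq_bot])
  hence 1: "[:-w, 1:] dvd poly M 0" by (simp add: poly_eq_0_iff_dvd)
  have "[:-w, 1:] dvd 1 - Q ^ n"
    using w by (simp add: poly_eq_0_iff_dvd [symmetric] Q_def)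
  hence "[:-w, 1:] ^ 2 dvd s0" unfolding s0_def by (rule dvd_power_same)
  hence "[:-w, 1:] ^ 2 * [:-w, 1:] dvd - s0 * poly M 0"
    using 1 by (intro mult_dvd_mono) auto
  also have "- s0 * poly M 0 = vsum Q n 0 (Suc m)" using G[of 0] by (simp add: M)
  finally show ?thesis by (simp add: Q_def power3_eq_cube power2_eq_square mult.assoc)
qed

subsection \<open>A terminating sum as a divided difference\<close>

text \<open>The Lagrange interpolant \<open>L\<close> of \<open>f\<close> equals \<open>f\<close> by
  counting roots. The sum is its coefficient in degree \<open>card I - 1\<close>, which exceeds the
  degree of \<open>f\<close>.\<close>

lemma sum_divided_difference_eq_0:
  fixes f :: "'a::field poly"
  assumes "finite I" "inj_on x I" "degree f + 1 < card I"
  shows "(\<Sum>k\<in>I. poly f (x k) / (\<Prod>j\<in>I - {k}. x k - x j)) = 0"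
proof -
  define c where "c k = poly f (x k) / (\<Prod>j\<in>I - {k}. x k - x j)" for k
  define b where "b k = (\<Prod>j\<in>I - {k}. [:- x j, 1:])" for k
  define L where "L = (\<Sum>k\<in>I. smult (c k) (b k))"
  have W: "(\<Prod>j\<in>I - {k}. x k - x j) \<noteq> 0" if "k \<in> I" for k
    using assms(1,2) that by (auto simp: inj_on_def)
  have deg_b: "degree (b k) = card I - 1" if "k \<in> I" for k
    unfolding b_def using that assms(1) by (subst degree_prod_eq_sum_degree) auto
  have lead_b: "coeff (b k) (card I - 1) = 1" if "k \<in> I" for k
    unfolding deg_b[OF that, symmetric] by (simp add: b_def lead_coeff_prod)
  have deg_L: "degree L \<le> card I - 1"
    unfolding L_def using deg_b
    by (intro degree_sum_le assms(1)) (metis degree_smult_le)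
  have L_at: "poly L (x k) = poly f (x k)" if "k \<in> I" for k
  proof -
    have "poly L (x k) = (\<Sum>l\<in>I. c l * poly (b l) (x k))"
      by (simp add: L_def poly_sum)
    also have "\<dots> = (\<Sum>l\<in>{k}. c l * poly (b l) (x k))"
      using assms(1) that
      by (intro sum.mono_neutral_right) (auto simp: b_def poly_prod)
    also have "\<dots> = poly f (x k)"
      using W[OF that] by (simp add: c_def b_def poly_prod)
    finally show ?thesis .
  qed
  have "L = f"
  proof (rule ccontr)
    assume "L \<noteq> f"
    hence ne: "L - f \<noteq> 0" by simp
    have "card I = card (x ` I)" using assms(2) by (simp add: card_image)
    also have "\<dots> \<le> card {a. poly (L - f) a = 0}"
      using L_at by (intro card_mono poly_roots_finite ne) auto
    also have "\<dots> \<le> degree (L - f)" using ne by (rule card_poly_roots_bound)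
    also have "\<dots> \<le> card I - 1" using deg_L assms(3) by (intro degree_diff_le) auto
    finally show False using assms(3) by simp
  qed
  have "coeff L (card I - 1) = (\<Sum>k\<in>I. c k * coeff (b k) (card I - 1))"
    by (simp add: L_def coeff_sum)
  also have "\<dots> = (\<Sum>k\<in>I. c k)"
    by (intro sum.cong refl) (simp only: lead_b mult_1_right)
  finally have "coeff L (card I - 1) = (\<Sum>k\<in>I. c k)" .
  thus ?thesis using \<open>L = f\<close> assms(3) by (simp add: c_def coeff_eq_0)
qed

lemma prod_lessThan_shift:
  fixes g :: "nat \<Rightarrow> 'a::comm_monoid_mult"
  shows "(\<Prod>i<M. g (Suc i)) * g 0 = (\<Prod>i<M. g i) * g M"
proof -
  have "(\<Prod>i<Suc M. g i) = g 0 * (\<Prod>i<M. g (Suc i))" by (rule prod.lessThan_Suc_shift)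
  thus ?thesis by (simp add: mult.commute)
qed

section \<open>The deformed sum at \<open>s = (1 - z ^ n) ^ 2\<close>\<close>

context
  fixes z u :: complex and m N n :: nat
  assumes z0: "z \<noteq> 0" and nz: "\<And>i. 0 < i \<Longrightarrow> i \<le> 4 * N + 1 \<Longrightarrow> z ^ i \<noteq> 1"
    and m: "m > 0" "N = Suc m" "n = 2 * m + 1" and u: "u = inverse z"
begin

definition node :: "nat \<Rightarrow> complex" where
  "node k = u ^ (2 * k) + z ^ (2 * k + 1)"

text \<open>The continuation of \<^const>\<open>node\<close> to the index \<open>-i\<close>.\<close>

definition node_neg :: "nat \<Rightarrow> complex" where
  "node_neg i = z ^ (2 * i) + z * u ^ (2 * i)"

text \<open>Value at \<open>node k\<close> of a polynomial of degree \<open>m - 1\<close>. Its roots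
  are chosen so that \<open>node_fun k / node_prod k\<close> is proportional to the
  \<open>k\<close>-th term of the deformed sum.\<close>

definition node_fun :: "nat \<Rightarrow> complex" where
  "node_fun k = (\<Prod>i<m - 1. node k - node_neg (Suc i))"

definition node_prod :: "nat \<Rightarrow> complex" where
  "node_prod k = (\<Prod>j\<in>{..N} - {k}. node k - node j)"

lemma uz: "u ^ a * z ^ a = 1" "z ^ a * u ^ a = 1" "u ^ a * (z ^ a * b) = b" "z ^ a * (u ^ a * b) = b"
proof -
  show 1: "u ^ a * z ^ a = 1" using z0 by (simp add: u power_inverse)
  show 2: "z ^ a * u ^ a = 1" using 1 by (simp only: mult.commute)
  show "u ^ a * (z ^ a * b) = b" by (simp only: mult.assoc[symmetric] 1 mult_1_left)
  show "z ^ a * (u ^ a * b) = b" by (simp only: mult.assoc[symmetric] 2 mult_1_left)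
qed

lemma node_diff: "node k - node j = (u ^ (2 * k) - u ^ (2 * j)) * (1 - z ^ (2 * k + 2 * j + 1))"
proof -
  have 1: "u ^ (2 * k) * z ^ (2 * k + 2 * j + 1) = z ^ (2 * j + 1)"
    by (simp only: power_add mult.assoc uz)
  have "u ^ (2 * j) * z ^ (2 * j + 2 * k + 1) = z ^ (2 * k + 1)"
    by (simp only: power_add mult.assoc uz)
  hence 2: "u ^ (2 * j) * z ^ (2 * k + 2 * j + 1) = z ^ (2 * k + 1)"
    by (simp only: add.commute[of "2 * j" "2 * k"])
  show ?thesis by (simp only: node_def left_diff_distrib right_diff_distrib 1 2) simp
qed

lemma node_diff_neg:
  "node k - node_neg i = (u ^ (2 * k) - z ^ (2 * i)) * (1 - z ^ (2 * k + 1) * u ^ (2 * i))"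
proof -
  have 1: "u ^ (2 * k) * (z ^ (2 * k + 1) * u ^ (2 * i)) = z * u ^ (2 * i)"
    by (simp only: power_add mult.assoc uz power_one_right)
  have 2: "z ^ (2 * i) * (z ^ (2 * k + 1) * u ^ (2 * i)) = z ^ (2 * k + 1)"
    by (simp only: mult.left_commute[of "z ^ (2 * i)"] uz mult_1_right)
  show ?thesis
    by (simp only: node_def node_neg_def left_diff_distrib right_diff_distrib 1 2) simp
qed

text \<open>By \<open>node_diff_neg\<close> each factor splits into \<open>p\<close> and
  \<open>r\<close>. Passing from \<open>k\<close> to \<open>k + 1\<close> shifts the index
  \<open>i\<close> up in \<open>p\<close> and down in \<open>r\<close>, so both products change only
  by boundary factors.\<close>

lemma node_fun_Suc:
  "node_fun (Suc k) * ((1 - z ^ (2 * k + 2)) * (z ^ (2 * m - 2) - z ^ (2 * k + 1))) =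
   node_fun k * ((1 - z ^ (2 * k + 2 * m)) * (1 - z ^ (2 * k + 1)))"
proof -
  define M where "M = m - 1"
  have mM: "m = Suc M" using m by (simp add: M_def)
  define p where "p k i = u ^ (2 * k) - z ^ (2 * i)" for k i
  define r where "r k i = 1 - z ^ (2 * k + 1) * u ^ (2 * i)" for k i
  have F: "node_fun k = (\<Prod>i<M. p k (Suc i)) * (\<Prod>i<M. r k (Suc i))" for k
    by (simp add: node_fun_def node_diff_neg prod.distrib p_def r_def M_def)
  have pS: "p (Suc k) i = u ^ 2 * p k (Suc i)" for i
    using uz(3)[of 2 "z ^ (2 * i)"]
    by (simp add: p_def right_diff_distrib power2_eq_square mult.assoc)
  have rS: "r (Suc k) (Suc i) = r k i" for i
  proof -
    have "z ^ (2 * Suc k + 1) * u ^ (2 * Suc i) = (z ^ 2 * u ^ 2) * (z ^ (2 * k + 1) * u ^ (2 * i))"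
      by (simp add: power2_eq_square mult_ac)
    thus ?thesis unfolding r_def uz by simp
  qed
  have 1: "(\<Prod>i<M. p (Suc k) (Suc i)) * p k 1 = u ^ (2 * M) * (\<Prod>i<M. p k (Suc i)) * p k m"
    using prod_lessThan_shift[where M = M and g = "\<lambda>i. p k (Suc i)"]
    by (simp add: pS prod.distrib power_mult mult.assoc mM)
  have 2: "(\<Prod>i<M. r (Suc k) (Suc i)) * r k M = (\<Prod>i<M. r k (Suc i)) * r k 0"
    using prod_lessThan_shift[where M = M and g = "r k"] by (simp add: rS)
  have 3: "p k i = u ^ (2 * k) * (1 - z ^ (2 * k + 2 * i))" for i
    by (simp add: p_def right_diff_distrib power_add uz)
  have 4: "r k M = u ^ (2 * M) * (z ^ (2 * M) - z ^ (2 * k + 1))"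
    by (simp add: r_def right_diff_distrib uz mult.commute)
  have 5: "r k 0 = 1 - z ^ (2 * k + 1)" by (simp add: r_def)
  \<comment> \<open>The prefactor turns the two factors on the left into \<open>p k 1\<close> and
    \<open>r k M\<close>; it is nonzero and is cancelled at the end.\<close>
  have "(u ^ (2 * k) * u ^ (2 * M)) *
      (node_fun (Suc k) * ((1 - z ^ (2 * k + 2)) * (z ^ (2 * m - 2) - z ^ (2 * k + 1)))) =
      ((\<Prod>i<M. p (Suc k) (Suc i)) * p k 1) * ((\<Prod>i<M. r (Suc k) (Suc i)) * r k M)"
    unfolding F 3 4 by (simp add: mM mult_ac)
  also have "\<dots> = (u ^ (2 * k) * u ^ (2 * M)) *
      (node_fun k * ((1 - z ^ (2 * k + 2 * m)) * (1 - z ^ (2 * k + 1))))"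
    unfolding 1 2 unfolding F 3 5 by (simp only: mult_ac)
  finally show ?thesis using z0 by (simp add: u)
qed

text \<open>By \<open>node_diff\<close> the product splits into \<open>B\<close> and a part that the
  missing factor \<open>1 - z ^ (4 * k + 1)\<close> for \<open>j = k\<close> completes to
  \<open>A\<close>. Both are then compared under an index shift.\<close>

lemma node_prod_Suc:
  assumes "k < N"
  shows "node_prod k * ((1 - z ^ (4 * k + 1)) * (1 - z ^ (n + 2 * k + 4)) * (1 - z ^ (2 * k + 2))) =
    node_prod (Suc k) * ((1 - z ^ (4 * k + 5)) * (z ^ (n + 1) - z ^ (2 * k)) * (1 - z ^ (2 * k + 1)))"
proof -
  define A where "A k = (\<Prod>j\<le>N. 1 - z ^ (2 * k + 2 * j + 1))" for k
  define B where "B k = (\<Prod>j\<in>{..N} - {k}. u ^ (2 * k) - u ^ (2 * j))" for k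
  have nN: "n + 1 = 2 * N" using m by simp
  have node_prod: "node_prod l * (1 - z ^ (4 * l + 1)) = A l * B l" if "l \<le> N" for l
  proof -
    have "A l = (1 - z ^ (2 * l + 2 * l + 1)) * (\<Prod>j\<in>{..N} - {l}. 1 - z ^ (2 * l + 2 * j + 1))"
      unfolding A_def using that by (intro prod.remove) auto
    thus ?thesis by (simp add: node_prod_def node_diff prod.distrib B_def mult_ac)
  qed
  have A: "A (Suc k) * (1 - z ^ (2 * k + 1)) = A k * (1 - z ^ (n + 2 * k + 4))"
  proof -
    define g where "g j = 1 - z ^ (2 * k + 2 * j + 1)" for j
    have "A (Suc k) = (\<Prod>j<Suc N. g (Suc j))" "A k = (\<Prod>j<Suc N. g j)"
      by (simp_all add: A_def g_def lessThan_Suc_atMost)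
    moreover have "2 * k + 2 * Suc N + 1 = n + 2 * k + 4" using m by simp
    hence "g (Suc N) = 1 - z ^ (n + 2 * k + 4)" by (simp only: g_def)
    moreover have "g 0 = 1 - z ^ (2 * k + 1)" by (simp add: g_def)
    ultimately show ?thesis using prod_lessThan_shift[of g "Suc N"] by simp
  qed
  define C where "C = (\<Prod>i\<in>{..<N} - {k}. u ^ (2 * k) - u ^ (2 * i))"
  have "{..N} - {k} = insert N ({..<N} - {k})" using assms by auto
  hence B1: "B k = (u ^ (2 * k) - u ^ (2 * N)) * C"
    unfolding B_def C_def by simp
  \<comment> \<open>Removing \<open>0\<close> and lowering the other indices by one exposes the same
    core \<open>C\<close> that is left in \<open>B k\<close> after removing
    \<open>N\<close>.\<close>
  have "{..N} - {Suc k} = insert 0 (Suc ` ({..<N} - {k}))"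
  proof (intro equalityI subsetI)
    fix j assume "j \<in> {..N} - {Suc k}"
    thus "j \<in> insert 0 (Suc ` ({..<N} - {k}))" by (cases j) auto
  qed auto
  hence "B (Suc k) = (u ^ (2 * Suc k) - 1) * (\<Prod>i\<in>{..<N} - {k}. u ^ (2 * Suc k) - u ^ (2 * Suc i))"
    unfolding B_def by (simp add: prod.reindex)
  also have "(\<Prod>i\<in>{..<N} - {k}. u ^ (2 * Suc k) - u ^ (2 * Suc i)) =
      (\<Prod>i\<in>{..<N} - {k}. u ^ 2 * (u ^ (2 * k) - u ^ (2 * i)))"
    by (intro prod.cong refl) (simp add: right_diff_distrib power2_eq_square mult.assoc)
  also have "\<dots> = u ^ (2 * m) * C"
    using assms m by (simp add: prod.distrib C_def power_mult)
  finally have B2: "B (Suc k) = (u ^ (2 * Suc k) - 1) * (u ^ (2 * m) * C)" .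
  have e1: "z ^ (n + 1) - z ^ (2 * k) = z ^ (2 * N + 2 * k) * (u ^ (2 * k) - u ^ (2 * N))"
  proof -
    have "z ^ (2 * N + 2 * k) * u ^ (2 * k) = z ^ (2 * N)"
      by (simp only: power_add mult.assoc uz mult_1_right)
    moreover have "z ^ (2 * k + 2 * N) * u ^ (2 * N) = z ^ (2 * k)"
      by (simp only: power_add mult.assoc uz mult_1_right)
    ultimately show ?thesis
      unfolding nN by (simp only: right_diff_distrib add.commute[of "2 * k"])
  qed
  have e2: "z ^ (2 * N + 2 * k) * ((u ^ (2 * Suc k) - 1) * u ^ (2 * m)) = 1 - z ^ (2 * k + 2)"
  proof -
    have "z ^ (2 * N + 2 * k) = z ^ (2 * Suc k) * z ^ (2 * m)"
      by (simp add: power_add [symmetric] m add.commute)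
    hence "z ^ (2 * N + 2 * k) * ((u ^ (2 * Suc k) - 1) * u ^ (2 * m)) =
        (z ^ (2 * Suc k) * u ^ (2 * Suc k) - z ^ (2 * Suc k)) * (z ^ (2 * m) * u ^ (2 * m))"
      by (simp add: left_diff_distrib right_diff_distrib mult_ac)
    thus ?thesis unfolding uz by simp
  qed
  have B: "B (Suc k) * (z ^ (n + 1) - z ^ (2 * k)) = B k * (1 - z ^ (2 * k + 2))"
    unfolding B1 B2 e1 e2[symmetric] by (simp only: mult_ac)
  have "node_prod k * ((1 - z ^ (4 * k + 1)) * (1 - z ^ (n + 2 * k + 4)) * (1 - z ^ (2 * k + 2))) =
      (A k * (1 - z ^ (n + 2 * k + 4))) * (B k * (1 - z ^ (2 * k + 2)))"
  proof -
    have "(A k * (1 - z ^ (n + 2 * k + 4))) * (B k * (1 - z ^ (2 * k + 2))) =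
        (A k * B k) * ((1 - z ^ (n + 2 * k + 4)) * (1 - z ^ (2 * k + 2)))"
      by (simp only: mult_ac)
    thus ?thesis unfolding node_prod[OF less_imp_le[OF assms], symmetric] by (simp only: mult_ac)
  qed
  also have "\<dots> = (A (Suc k) * B (Suc k)) * ((1 - z ^ (2 * k + 1)) * (z ^ (n + 1) - z ^ (2 * k)))"
    unfolding A[symmetric] B[symmetric] by (simp only: mult_ac)
  also have "A (Suc k) * B (Suc k) = node_prod (Suc k) * (1 - z ^ (4 * k + 5))"
    using node_prod[of "Suc k"] assms by (simp add: add.commute)
  finally show ?thesis by (simp only: mult_ac)
qed

lemma power_neq:
  assumes "a < b" "b \<le> a + (4 * N + 1)"
  shows "z ^ a \<noteq> z ^ b"
proof
  assume "z ^ a = z ^ b"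
  also have "z ^ b = z ^ a * z ^ (b - a)" using assms by (simp add: power_add [symmetric])
  finally have "z ^ (b - a) = 1" using z0 by simp
  thus False using nz[of "b - a"] assms by auto
qed

lemma node_neq:
  assumes "k \<le> N" "j \<le> N" "k \<noteq> j"
  shows "node k \<noteq> node j"
proof -
  have "z ^ (2 * k) \<noteq> z ^ (2 * j)"
    using power_neq[of "2 * k" "2 * j"] power_neq[of "2 * j" "2 * k"] assms
    by (cases "k < j") auto
  hence "u ^ (2 * k) \<noteq> u ^ (2 * j)" by (simp add: u power_inverse)
  moreover have "z ^ (2 * k + 2 * j + 1) \<noteq> 1" using assms by (intro nz) auto
  ultimately have "node k - node j \<noteq> 0" unfolding node_diff by auto
  thus ?thesis by simp
qed

lemma node_prod_neq_0: "k \<le> N \<Longrightarrow> node_prod k \<noteq> 0"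
  unfolding node_prod_def using node_neq by force

lemma node_fun_0_neq_0: "node_fun 0 \<noteq> 0"
proof -
  have "node 0 - node_neg (Suc i) \<noteq> 0" if "i < m - 1" for i
  proof -
    have "z ^ (2 * Suc i) \<noteq> 1" using that m by (intro nz) auto
    moreover have "z ^ 1 \<noteq> z ^ (2 * Suc i)" using that m by (intro power_neq) auto
    hence "1 - z * u ^ (2 * Suc i) \<noteq> 0"
    proof -
      have "z = z ^ (2 * Suc i)" if "z * u ^ (2 * Suc i) = 1"
        using arg_cong[OF that, of "\<lambda>a. a * z ^ (2 * Suc i)"] unfolding mult.assoc uz by simp
      thus ?thesis using \<open>z ^ 1 \<noteq> z ^ (2 * Suc i)\<close> by auto
    qed
    ultimately show ?thesis unfolding node_diff_neg by auto
  qed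
  thus ?thesis unfolding node_fun_def by (simp add: prod_zero_iff)
qed

text \<open>There are \<open>m + 2\<close> nodes and the polynomial has degree \<open>m - 1\<close>,
  so its divided difference vanishes.\<close>

lemma sum_node_fun: "(\<Sum>k\<le>N. node_fun k / node_prod k) = 0"
proof -
  define f where "f = (\<Prod>i<m - 1. [:- node_neg (Suc i), 1:])"
  have "degree f = m - 1"
    unfolding f_def by (subst degree_prod_eq_sum_degree) auto
  moreover have "inj_on node {..N}" using node_neq by (auto simp: inj_on_def)
  moreover have "poly f (node k) = node_fun k" for k
    by (simp add: f_def poly_prod node_fun_def)
  ultimately show ?thesis
    using sum_divided_difference_eq_0[of "{..N}" node f] m(1,2)
    unfolding node_prod_def by (simp only: finite_atMost card_atMost)
qed

text \<open>For this \<open>s\<close> the deformed quadratic factor splits as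
  \<open>(z - a * b) * (a * z - b)\<close>, where \<open>a = z ^ n\<close>. The right-hand side is
  grouped to match first \<open>node_fun_Suc\<close>, then \<open>node_prod_Suc\<close>; likewise in
  \<open>vden_special\<close>.\<close>

lemma vnum_special:
  "vnum z n ((1 - z ^ n) ^ 2) k = z ^ 3 * ((1 - z ^ (2 * k + 2 * m)) * (1 - z ^ (2 * k + 1))) *
      ((z ^ (n + 1) - z ^ (2 * k)) * (1 - z ^ (2 * k + 1)))"
proof -
  define a b where "a = z ^ n" and "b = z ^ (2 * k)"
  have 1: "z * (1 - z ^ (2 * k + 2 * m)) = z - a * b"
    by (simp add: a_def b_def m power_add algebra_simps)
  have 2: "a * (z - b) ^ 2 - (1 - a) ^ 2 * (b * z) = (z - a * b) * (a * z - b)"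
    by (simp add: power2_eq_square algebra_simps)
  have "vnum z n ((1 - z ^ n) ^ 2) k = z ^ 2 * ((z - a * b) * (a * z - b)) * (1 - z ^ (2 * k + 1)) ^ 2"
    unfolding vnum_def a_def[symmetric] b_def[symmetric] 2[symmetric]
    by (simp add: b_def mult.commute)
  also have "\<dots> = z ^ 2 * (z * (1 - z ^ (2 * k + 2 * m))) * (a * z - b) * (1 - z ^ (2 * k + 1)) ^ 2"
    unfolding 1 by (simp only: mult.assoc)
  finally show ?thesis
    unfolding a_def b_def by (simp add: power2_eq_square power3_eq_cube mult_ac)
qed

lemma vden_special:
  "vden z n ((1 - z ^ n) ^ 2) k = z ^ 3 * ((1 - z ^ (2 * k + 2)) * (z ^ (2 * m - 2) - z ^ (2 * k + 1))) *
      ((1 - z ^ (n + 2 * k + 4)) * (1 - z ^ (2 * k + 2)))"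
proof -
  define a b where "a = z ^ n" and "b = z ^ (2 * k + 4)"
  have "z ^ 3 * z ^ (2 * m - 2) = z ^ n"
    using m by (simp add: power_add [symmetric])
  moreover have "z ^ 3 * z ^ (2 * k + 1) = b"
    unfolding b_def power_add [symmetric] by (rule arg_cong[of _ _ "(^) z"]) simp
  ultimately have 1: "z ^ 3 * (z ^ (2 * m - 2) - z ^ (2 * k + 1)) = a - b"
    by (simp only: a_def right_diff_distrib)
  have 2: "a * (1 - b) ^ 2 - (1 - a) ^ 2 * b = (1 - a * b) * (a - b)"
    by (simp add: power2_eq_square algebra_simps)
  have 3: "z ^ (n + 2 * k + 4) = a * b" by (simp add: a_def b_def power_add)
  have "vden z n ((1 - z ^ n) ^ 2) k = (1 - a * b) * (a - b) * (1 - z ^ (2 * k + 2)) ^ 2"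
    unfolding vden_def a_def[symmetric] b_def[symmetric] 2 ..
  thus ?thesis
    unfolding 1[symmetric] 3 by (simp only: power2_eq_square mult_ac)
qed

text \<open>The quotients \<open>v k\<close> satisfy the recurrence of the terms, so
  \<open>v 0\<close> times the sum is a multiple of the vanishing \<open>sum_node_fun\<close>, and
  \<open>v 0\<close> is nonzero.\<close>

lemma vsum_special_eq_0_aux: "vsum z n ((1 - z ^ n) ^ 2) N = 0"
proof -
  define s where "s = (1 - z ^ n) ^ 2"
  define v where "v k = node_fun k / node_prod k" for k
  have step: "v (Suc k) * (1 - z ^ (4 * k + 1)) * vden z n s k =
      v k * (1 - z ^ (4 * k + 5)) * vnum z n s k" if "k < N" for k
  proof -
    have "(node_fun (Suc k) * ((1 - z ^ (4 * k + 1)) * vden z n s k)) * node_prod k =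
       z ^ 3 * (node_fun (Suc k) * ((1 - z ^ (2 * k + 2)) * (z ^ (2 * m - 2) - z ^ (2 * k + 1)))) *
       (node_prod k * ((1 - z ^ (4 * k + 1)) * (1 - z ^ (n + 2 * k + 4)) * (1 - z ^ (2 * k + 2))))"
      unfolding s_def vden_special by (simp only: mult_ac)
    also have "\<dots> = (node_fun k * ((1 - z ^ (4 * k + 5)) * vnum z n s k)) * node_prod (Suc k)"
      unfolding s_def vnum_special node_fun_Suc node_prod_Suc[OF that] by (simp only: mult_ac)
    finally show ?thesis
      using node_prod_neq_0[of k] node_prod_neq_0[of "Suc k"] that
      by (simp add: v_def frac_eq_eq mult.assoc)
  qed
  have key: "v 0 * (1 - z ^ (4 * k + 1)) * (\<Prod>j<k. vnum z n s j) =
      v k * (1 - z) * (\<Prod>j<k. vden z n s j)" if "k \<le> N" for k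
    using that
  proof (induction k)
    case (Suc k)
    have e: "4 * Suc k + 1 = 4 * k + 5" by simp
    \<comment> \<open>The recurrence \<open>step\<close> carries the factor
      \<open>1 - z ^ (4 * k + 1)\<close>, which is inserted here and cancelled by
      \<open>nz\<close>.\<close>
    have "(1 - z ^ (4 * k + 1)) * (v 0 * (1 - z ^ (4 * Suc k + 1)) * (\<Prod>j<Suc k. vnum z n s j)) =
       (v 0 * (1 - z ^ (4 * k + 1)) * (\<Prod>j<k. vnum z n s j)) * ((1 - z ^ (4 * k + 5)) * vnum z n s k)"
      unfolding e by (simp add: mult_ac)
    also have "\<dots> = (v k * (1 - z ^ (4 * k + 5)) * vnum z n s k) * ((1 - z) * (\<Prod>j<k. vden z n s j))"
      using Suc by (simp add: mult_ac)
    also have "\<dots> = (1 - z ^ (4 * k + 1)) * (v (Suc k) * (1 - z) * (\<Prod>j<Suc k. vden z n s j))"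
      unfolding step[of k, OF Suc_le_lessD[OF Suc.prems], symmetric] by (simp add: mult_ac)
    finally have "(1 - z ^ (4 * k + 1)) * (v 0 * (1 - z ^ (4 * Suc k + 1)) * (\<Prod>j<Suc k. vnum z n s j)) =
      (1 - z ^ (4 * k + 1)) * (v (Suc k) * (1 - z) * (\<Prod>j<Suc k. vden z n s j))" .
    moreover have "1 - z ^ (4 * k + 1) \<noteq> 0" using nz[of "4 * k + 1"] Suc.prems by simp
    ultimately show ?case by (metis mult_left_cancel)
  qed simp
  have scaled: "v 0 * (qint z (4 * k + 1) * vterm z n s N k) = v k * (\<Prod>j<N. vden z n s j)"
    if "k \<le> N" for k
  proof -
    have "(\<Prod>j<N. vden z n s j) = (\<Prod>j<k. vden z n s j) * (\<Prod>j\<in>{k..<N}. vden z n s j)"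
      using prod.atLeastLessThan_concat[of 0 k N "vden z n s"] that by (simp add: atLeast0LessThan)
    hence "(1 - z) * (v 0 * (qint z (4 * k + 1) * vterm z n s N k)) =
        (1 - z) * (v k * (\<Prod>j<N. vden z n s j))"
      using key[OF that] unfolding vterm_def qint_geometric[symmetric] by (auto simp: mult_ac)
    thus ?thesis using nz[of 1] by simp
  qed
  have "v 0 * vsum z n s N = (\<Sum>k\<le>N. v k) * (\<Prod>j<N. vden z n s j)"
    unfolding vsum_def sum_distrib_left sum_distrib_right
    by (intro sum.cong refl) (simp only: atMost_iff scaled)
  also have "(\<Sum>k\<le>N. v k) = 0" unfolding v_def by (rule sum_node_fun)
  finally show ?thesis
    using node_fun_0_neq_0 node_prod_neq_0[of 0] by (simp add: v_def s_def)
qed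

end

lemma eventually_not_root_of_unity:
  "\<forall>\<^sub>F z in cofinite. \<forall>i\<in>{0<..b}. (z :: complex) ^ i \<noteq> 1"
proof -
  have "finite {z :: complex. z ^ i = 1}" if "i > 0" for i
    using that by (intro finite_roots_unity) simp
  thus ?thesis
    by (subst eventually_ball_finite_distrib) (auto simp: eventually_cofinite)
qed

lemma vsum_special_eq_0:
  assumes "m > 0" "n = 2 * m + 1"
  shows "\<forall>\<^sub>F z :: complex in cofinite. vsum z n ((1 - z ^ n) ^ 2) (Suc m) = 0"
proof -
  have "\<forall>\<^sub>F z :: complex in cofinite. z \<noteq> 0" by (simp add: eventually_cofinite)
  with eventually_not_root_of_unity[of "4 * Suc m + 1"] show ?thesis
  proof eventually_elim
    case (elim z)
    thus ?case using assms by (intro vsum_special_eq_0_aux[of z "Suc m" m n]) auto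
  qed
qed

subsection \<open>Limits of the terms at roots of unity\<close>

text \<open>The summand of the theorem as a complex function. Where its denominator vanishes only
  its limit is meaningful.\<close>

definition sterm :: "complex \<Rightarrow> nat \<Rightarrow> complex" where
  "sterm z k = qint z (4 * k + 1) *
     ((qpoch (inverse z) (z ^ 2) k) ^ 2 * (qpoch z (z ^ 2) k) ^ 2 /
      ((qpoch (z ^ 4) (z ^ 2) k) ^ 2 * (qpoch (z ^ 2) (z ^ 2) k) ^ 2)) * z ^ (4 * k)"

text \<open>The factor \<open>z ^ (n * k)\<close> stems from the scaling \<open>s = t q^n\<close>;
  it recurs in \<open>prod_vden_0\<close> and cancels in the quotient.\<close>

lemma prod_vnum_0:
  assumes "z \<noteq> 0"
  shows "(\<Prod>j<k. vnum z n 0 j) = z ^ (n * k) *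
    ((qpoch (inverse z) (z ^ 2) k) ^ 2 * (qpoch z (z ^ 2) k) ^ 2 * z ^ (4 * k) :: complex)"
proof -
  have "vnum z n 0 j = z ^ n * ((1 - inverse z * (z ^ 2) ^ j) ^ 2 * (1 - z * (z ^ 2) ^ j) ^ 2 * z ^ 4)" for j
  proof -
    define a b where "a = 1 - inverse z * (z ^ 2) ^ j" and "b = 1 - z * (z ^ 2) ^ j"
    have "z * a = z - z ^ (2 * j)" "b = 1 - z ^ (2 * j + 1)"
      using assms by (simp_all add: a_def b_def power_mult right_diff_distrib)
    hence "vnum z n 0 j = z ^ 2 * (z ^ n * (z * a) ^ 2) * b ^ 2"
      by (simp add: vnum_def)
    also have "\<dots> = z ^ n * (a ^ 2 * b ^ 2 * z ^ 4)"
      by (simp add: eval_nat_numeral mult_ac)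
    finally show ?thesis by (simp only: a_def b_def)
  qed
  hence "(\<Prod>j<k. vnum z n 0 j) =
    (\<Prod>j<k. z ^ n * ((1 - inverse z * (z ^ 2) ^ j) ^ 2 * (1 - z * (z ^ 2) ^ j) ^ 2 * z ^ 4))"
    by (rule prod.cong[OF refl])
  thus ?thesis
    by (simp add: prod.distrib qpoch_def power_mult prod_power_distrib)
qed

lemma prod_vden_0:
  "(\<Prod>j<k. vden z n 0 j) = z ^ (n * k) *
    ((qpoch (z ^ 4) (z ^ 2) k) ^ 2 * (qpoch (z ^ 2) (z ^ 2) k) ^ 2 :: complex)"
proof -
  have "vden z n 0 j = z ^ n * ((1 - z ^ 4 * (z ^ 2) ^ j) ^ 2 * (1 - z ^ 2 * (z ^ 2) ^ j) ^ 2)" for j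
    unfolding vden_def power_add power_mult by (simp only: mult_ac) simp
  hence "(\<Prod>j<k. vden z n 0 j) =
    (\<Prod>j<k. z ^ n * ((1 - z ^ 4 * (z ^ 2) ^ j) ^ 2 * (1 - z ^ 2 * (z ^ 2) ^ j) ^ 2))"
    by (rule prod.cong[OF refl])
  thus ?thesis
    by (simp add: prod.distrib qpoch_def power_mult prod_power_distrib)
qed

lemma sum_sterm_eq_vsum:
  assumes "z \<noteq> 0" "(\<Prod>j<N. vden z n 0 j) \<noteq> 0"
  shows "(\<Sum>k\<le>N. sterm z k) * (\<Prod>j<N. vden z n 0 j) = vsum z n 0 N"
proof -
  have "sterm z k * (\<Prod>j<N. vden z n 0 j) = qint z (4 * k + 1) * vterm z n 0 N k" if "k \<le> N" for k
  proof -
    have split: "(\<Prod>j<N. vden z n 0 j) = (\<Prod>j<k. vden z n 0 j) * (\<Prod>j\<in>{k..<N}. vden z n 0 j)"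
      using prod.atLeastLessThan_concat[of 0 k N "vden z n 0"] that by (simp add: atLeast0LessThan)
    have "sterm z k = qint z (4 * k + 1) * ((\<Prod>j<k. vnum z n 0 j) / (\<Prod>j<k. vden z n 0 j))"
      unfolding prod_vnum_0[OF assms(1)] prod_vden_0 sterm_def using assms(1) by simp
    thus ?thesis using assms(2) unfolding split vterm_def by simp
  qed
  thus ?thesis
    unfolding vsum_def sum_distrib_right by (intro sum.cong refl) (simp only: atMost_iff)
qed

lemma eventually_at_if_cofinite:
  fixes w :: "'a::t1_space"
  assumes "\<forall>\<^sub>F z in cofinite. P z"
  shows "\<forall>\<^sub>F z in at w. P z"
proof -
  define T where "T = {z. \<not> P z} - {w}"
  have "finite T" using assms by (simp add: T_def eventually_cofinite)
  hence "open (- T)" by (simp add: finite_imp_closed open_Compl)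
  thus ?thesis
    unfolding eventually_at_topological by (intro exI[of _ "- T"]) (auto simp: T_def)
qed

definition qratio :: "nat \<Rightarrow> complex \<Rightarrow> complex" where
  "qratio k z = (\<Prod>i<k. (1 - z ^ (2 * i + 1)) / (1 - z ^ (2 * i + 2)))"

text \<open>An index shift by one relates \<open>(z^-1;z^2)_k\<close> to \<open>(z;z^2)_k\<close>
  and \<open>(z^4;z^2)_k\<close> to \<open>(z^2;z^2)_k\<close> up to boundary factors, leaving a
  fourth power of one ratio.\<close>

lemma sterm_qratio:
  assumes "z \<noteq> 0" "z \<noteq> z ^ (2 * k)" "z ^ 2 \<noteq> 1"
  shows "sterm z k = qint z (4 * k + 1) * qratio k z ^ 4 *
    ((z - 1) * (1 - z ^ 2) / ((z - z ^ (2 * k)) * (1 - z ^ (2 * k + 2)))) ^ 2 * z ^ (4 * k)"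
proof -
  define a b c p where "a = qpoch z (z ^ 2) k" and "b = qpoch (z ^ 2) (z ^ 2) k"
    and "c = qpoch (inverse z) (z ^ 2) k" and "p = qpoch (z ^ 4) (z ^ 2) k"
  have e: "inverse z * (z ^ 2) ^ Suc j = z * (z ^ 2) ^ j" for j
    using assms(1) by (simp add: power2_eq_square)
  have "a * (1 - inverse z) = c * (1 - inverse z * (z ^ 2) ^ k)"
    using prod_lessThan_shift[where M = k and g = "\<lambda>j. 1 - inverse z * (z ^ 2) ^ j"]
    unfolding e by (simp add: a_def c_def qpoch_def)
  hence "a * (z * (1 - inverse z)) = c * (z * (1 - inverse z * (z ^ 2) ^ k))"
    by (simp only: mult.left_commute[of _ z])
  hence "a * (z - 1) = c * (z - z ^ (2 * k))"
    using assms(1) by (simp add: right_diff_distrib power_mult)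
  hence c: "c = a * (z - 1) / (z - z ^ (2 * k))" using assms(2) by (simp add: field_simps)
  have e': "z ^ 2 * (z ^ 2) ^ Suc j = z ^ 4 * (z ^ 2) ^ j" for j
    by (simp add: eval_nat_numeral mult_ac)
  have e'': "z ^ (2 * k + 2) = z ^ 2 * (z ^ 2) ^ k"
    unfolding power_add power_mult by (rule mult.commute)
  have "p * (1 - z ^ 2 * (z ^ 2) ^ 0) = b * (1 - z ^ 2 * (z ^ 2) ^ k)"
    using prod_lessThan_shift[where M = k and g = "\<lambda>j. 1 - z ^ 2 * (z ^ 2) ^ j"]
    unfolding e' p_def b_def qpoch_def .
  hence "p * (1 - z ^ 2) = b * (1 - z ^ (2 * k + 2))"
    by (simp only: e'' power_0 mult_1_right)
  hence p: "p = b * (1 - z ^ (2 * k + 2)) / (1 - z ^ 2)" using assms(3) by (simp add: field_simps)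
  have r: "qratio k z = a / b"
  proof -
    have "z ^ (2 * i + 1) = z * (z ^ 2) ^ i" "z ^ (2 * i + 2) = z ^ 2 * (z ^ 2) ^ i" for i
      unfolding power_add power_mult power_one_right by (rule mult.commute)+
    thus ?thesis by (simp only: qratio_def a_def b_def qpoch_def prod_dividef)
  qed
  show ?thesis
    unfolding sterm_def a_def[symmetric] b_def[symmetric] c_def[symmetric] p_def[symmetric] c p r
    by (simp add: power_divide power_mult_distrib eval_nat_numeral mult_ac)
qed

lemma sum_lessThan_add:
  fixes f :: "nat \<Rightarrow> 'a::comm_monoid_add"
  shows "sum f {..<a + b} = sum f {..<a} + (\<Sum>i<b. f (a + i))"
  by (induction b) (simp_all add: add.assoc)

section \<open>Blocks at a root of unity \<open>w\<close> of odd order \<open>d\<close>\<close>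

context
  fixes w :: complex and d h :: nat
  assumes d: "d = 2 * h + 1" and h: "h \<ge> 1"
    and wd: "w ^ d = 1" and prim: "\<And>i. 0 < i \<Longrightarrow> i < d \<Longrightarrow> w ^ i \<noteq> 1"
begin

lemma w_neq_0: "w \<noteq> 0"
  using wd d by (auto simp: power_0_left)

lemma w_power_mod: "w ^ (i mod d) = w ^ i"
proof -
  have "w ^ i = w ^ (d * (i div d) + i mod d)" by simp
  also have "\<dots> = w ^ (i mod d)"
    unfolding power_add power_mult wd by simp
  finally show ?thesis ..
qed

lemma w_power_eq_1: "w ^ i = 1 \<longleftrightarrow> d dvd i"
  using prim[of "i mod d"] w_power_mod[of i] d mod_less_divisor[of d i]
  by (cases "i mod d = 0") (auto simp: dvd_eq_mod_eq_0)

text \<open>The factor \<open>1 - z ^ a\<close> stripped of its possible zero at \<open>w\<close>,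
  in a form continuous and, for \<open>a > 0\<close>, nonzero there.\<close>

definition unit_part :: "nat \<Rightarrow> complex \<Rightarrow> complex" where
  "unit_part a z = (if d dvd a then qint (z ^ d) (a div d) else 1 - z ^ a)"

lemma unit_part: "1 - z ^ a = unit_part a z * (1 - z ^ d) ^ of_bool (d dvd a)"
  using qint_geometric[of "z ^ d" "a div d"]
  by (auto simp: unit_part_def power_mult [symmetric] mult.commute)

lemma unit_part_neq_0: "a > 0 \<Longrightarrow> unit_part a w \<noteq> 0"
  using w_power_eq_1[of a] by (auto simp: unit_part_def wd qint_def)

lemma isCont_unit_part: "isCont (unit_part a) w"
  by (cases "d dvd a") (auto simp: unit_part_def [abs_def] qint_def intro!: continuous_intros)

definition unit_ratio :: "nat \<Rightarrow> complex \<Rightarrow> complex" where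
  "unit_ratio k z = (\<Prod>i<k. unit_part (2 * i + 1) z / unit_part (2 * i + 2) z)"

lemma isCont_unit_ratio: "isCont (unit_ratio k) w"
proof (induction k)
  case (Suc k)
  have "isCont (\<lambda>z. unit_part (2 * k + 1) z / unit_part (2 * k + 2) z) w"
    by (intro isCont_divide isCont_unit_part unit_part_neq_0) simp
  from isCont_mult[OF Suc.IH this] show ?case by (simp add: unit_ratio_def)
qed (simp add: unit_ratio_def)

lemma dvd_odd: "d dvd 2 * k + 1 \<longleftrightarrow> d dvd Suc (k + h)"
proof -
  have "coprime d 2" by (simp add: d)
  hence "d dvd Suc (k + h) \<longleftrightarrow> d dvd 2 * Suc (k + h)"
    by (simp only: coprime_dvd_mult_right_iff)
  also have "2 * Suc (k + h) = (2 * k + 1) + d" by (simp add: d)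
  also have "d dvd \<dots> \<longleftrightarrow> d dvd 2 * k + 1" by (rule dvd_add_triv_right_iff)
  finally show ?thesis ..
qed

lemma dvd_even: "d dvd 2 * k + 2 \<longleftrightarrow> d dvd Suc k"
proof -
  have "coprime d 2" by (simp add: d)
  hence "d dvd Suc k \<longleftrightarrow> d dvd 2 * Suc k"
    by (simp only: coprime_dvd_mult_right_iff)
  thus ?thesis by simp
qed

text \<open>Counts the zeros at \<open>w\<close>: among the exponents \<open>2 * i + 1\<close> with
  \<open>i < k\<close> there are \<open>(k + h) div d\<close> multiples of \<open>d\<close>, among
  the \<open>2 * i + 2\<close> there are \<open>k div d\<close>.\<close>

lemma qratio_unit_ratio:
  assumes "z ^ d \<noteq> 1"
  shows "qratio k z * (1 - z ^ d) ^ (k div d) = unit_ratio k z * (1 - z ^ d) ^ ((k + h) div d)"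
proof (induction k)
  case 0
  have "h div d = 0" using d by simp
  thus ?case by (simp add: qratio_def unit_ratio_def)
next
  case (Suc k)
  define y where "y = 1 - z ^ d"
  have y: "y \<noteq> 0" using assms by (simp add: y_def)
  have S: "Suc k div d = k div d + of_bool (d dvd Suc k)" for k
    using d by (simp add: div_Suc dvd_eq_mod_eq_0)
  have u: "1 - z ^ (2 * k + 1) = unit_part (2 * k + 1) z * y ^ of_bool (d dvd Suc (k + h))"
    "1 - z ^ (2 * k + 2) = unit_part (2 * k + 2) z * y ^ of_bool (d dvd Suc k)"
    using unit_part[of z "2 * k + 1"] unit_part[of z "2 * k + 2"]
    by (simp_all only: y_def dvd_odd dvd_even)
  have "qratio (Suc k) z = qratio k z * ((1 - z ^ (2 * k + 1)) / (1 - z ^ (2 * k + 2)))"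
    by (simp add: qratio_def)
  hence 1: "qratio (Suc k) z = qratio k z *
      (unit_part (2 * k + 1) z * y ^ of_bool (d dvd Suc (k + h)) /
      (unit_part (2 * k + 2) z * y ^ of_bool (d dvd Suc k)))"
    unfolding u .
  have "qratio (Suc k) z * y ^ (Suc k div d) = 
    (qratio k z * y ^ (k div d)) * (unit_part (2 * k + 1) z / unit_part (2 * k + 2) z) *
      y ^ of_bool (d dvd Suc (k + h))"
    unfolding 1 S power_add using y by simp
  also have "qratio k z * y ^ (k div d) = unit_ratio k z * y ^ ((k + h) div d)"
    unfolding y_def by (rule Suc.IH)
  also have "\<dots> * (unit_part (2 * k + 1) z / unit_part (2 * k + 2) z) *
      y ^ of_bool (d dvd Suc (k + h)) = unit_ratio (Suc k) z * y ^ (Suc (k + h) div d)"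
    unfolding S power_add by (simp add: unit_ratio_def)
  finally show ?case by (simp add: y_def)
qed

lemma eventually_generic:
  "\<forall>\<^sub>F z in at w. z \<noteq> 0 \<and> z ^ d \<noteq> 1 \<and> z ^ 2 \<noteq> 1 \<and> z \<noteq> z ^ (2 * k)"
proof -
  have "\<forall>\<^sub>F z :: complex in cofinite. z \<noteq> 0" by (simp add: eventually_cofinite)
  with eventually_not_root_of_unity[of "d + 2 * k + 2"]
  have "\<forall>\<^sub>F z :: complex in cofinite. z \<noteq> 0 \<and> z ^ d \<noteq> 1 \<and> z ^ 2 \<noteq> 1 \<and> z \<noteq> z ^ (2 * k)"
  proof eventually_elim
    case (elim z)
    have "z \<noteq> z ^ (2 * k)"
    proof (cases "k = 0")
      case True
      thus ?thesis using elim(1)[rule_format, of 1] by simp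
    next
      case False
      have "z ^ (2 * k) = z * z ^ (2 * k - 1)" using False by (simp flip: power_Suc)
      thus ?thesis using False elim(1)[rule_format, of "2 * k - 1"] elim(2) by auto
    qed
    moreover have "d \<in> {0<..d + 2 * k + 2}" "2 \<in> {0<..d + 2 * k + 2}" using d by simp_all
    ultimately show ?case using elim by blast
  qed
  thus ?thesis by (rule eventually_at_if_cofinite)
qed

lemma w_square_neq_1: "w ^ 2 \<noteq> 1"
  using prim[of 2] d h by auto

text \<open>
  For \<open>k mod d > h\<close> the fourth power of \<^const>\<open>qratio\<close> has a zero of order 4 at \<open>w\<close>, against
  poles of order 2 for each of \<open>d dvd 2 * k - 1\<close> and \<open>d dvd 2 * k + 2\<close>; if both hold, then
  \<open>d dvd 4 * k + 1\<close> and the factor \<open>[4 k + 1]\<close> vanishes.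
\<close>

lemma tendsto_sterm_large:
  assumes "k mod d > h"
  shows "((\<lambda>z. sterm z k) \<longlongrightarrow> 0) (at w)"
proof -
  have k: "k > 0" using assms by (cases k) auto
  have kd: "(k + h) div d = k div d + 1"
  proof -
    define s where "s = k mod d"
    have "s < d" using d by (simp add: s_def)
    moreover have "h < s" using assms by (simp add: s_def)
    ultimately have "(s + h) div d = 1" using d by (intro div_nat_eqI) simp_all
    moreover have "k + h = (s + h) + d * (k div d)" by (simp add: s_def)
    moreover have "d \<noteq> 0" using d by simp
    ultimately show ?thesis by (metis add.commute div_mult_self2)
  qed
  define \<alpha> \<beta> :: nat where "\<alpha> = of_bool (d dvd 2 * k - 1)" and "\<beta> = of_bool (d dvd 2 * k + 2)"
  \<comment> \<open>\<open>T\<close> collects what is regular at \<open>w\<close>; besides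
    \<open>[4k+1]\<close>, the term retains only a power of \<open>1 - z ^ d\<close>.\<close>
  define T where "T z = unit_ratio k z ^ 4 *
    ((z - 1) * (1 - z ^ 2) / (z * unit_part (2 * k - 1) z * unit_part (2 * k + 2) z)) ^ 2 * z ^ (4 * k)"
    for z
  have "isCont T w"
    unfolding T_def [abs_def] using w_neq_0 unit_part_neq_0 k
    by (intro continuous_intros isCont_unit_ratio isCont_unit_part) auto
  moreover have "isCont (\<lambda>z. qint z (4 * k + 1)) w" "isCont (\<lambda>z. (1 - z ^ d) ^ (4 - 2 * \<alpha> - 2 * \<beta>)) w"
    unfolding qint_def by (intro continuous_intros)+
  ultimately have "isCont (\<lambda>z. qint z (4 * k + 1) * T z * (1 - z ^ d) ^ (4 - 2 * \<alpha> - 2 * \<beta>)) w"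
    by (intro continuous_intros)
  hence lim: "((\<lambda>z. qint z (4 * k + 1) * T z * (1 - z ^ d) ^ (4 - 2 * \<alpha> - 2 * \<beta>)) \<longlongrightarrow>
     qint w (4 * k + 1) * T w * (1 - w ^ d) ^ (4 - 2 * \<alpha> - 2 * \<beta>)) (at w)"
    by (simp add: isCont_def)
  have zero: "qint w (4 * k + 1) * (1 - w ^ d) ^ (4 - 2 * \<alpha> - 2 * \<beta>) = 0"
  proof (cases "d dvd 2 * k - 1 \<and> d dvd 2 * k + 2")
    case True
    hence "d dvd (2 * k - 1) + (2 * k + 2)" using dvd_add by blast
    also have "(2 * k - 1) + (2 * k + 2) = 4 * k + 1" using k by simp
    finally have "w ^ (4 * k + 1) = 1" using w_power_eq_1 by blast
    hence "(1 - w) * qint w (4 * k + 1) = 0" unfolding qint_geometric by simp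
    moreover have "w \<noteq> 1" using prim[of 1] d h by simp
    ultimately show ?thesis by simp
  next
    case False
    thus ?thesis using wd by (auto simp: \<alpha>_def \<beta>_def)
  qed
  have "\<forall>\<^sub>F z in at w. qint z (4 * k + 1) * T z * (1 - z ^ d) ^ (4 - 2 * \<alpha> - 2 * \<beta>) = sterm z k"
    using eventually_generic[of k]
  proof eventually_elim
    case (elim z)
    define y where "y = 1 - z ^ d"
    have y: "y \<noteq> 0" using elim by (simp add: y_def)
    have q: "qratio k z = unit_ratio k z * y"
      using qratio_unit_ratio[of z k] elim y unfolding kd by (simp add: y_def)
    have "z - z ^ (2 * k) = z * (1 - z ^ (2 * k - 1))"
      using k by (simp add: right_diff_distrib flip: power_Suc)
    hence 1: "z - z ^ (2 * k) = z * (unit_part (2 * k - 1) z * y ^ \<alpha>)"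
      using unit_part[of z "2 * k - 1"] by (simp add: \<alpha>_def y_def)
    have 2: "1 - z ^ (2 * k + 2) = unit_part (2 * k + 2) z * y ^ \<beta>"
      using unit_part[of z "2 * k + 2"] by (simp only: \<beta>_def y_def)
    have "\<alpha> \<le> 1" "\<beta> \<le> 1" by (auto simp: \<alpha>_def \<beta>_def)
    \<comment> \<open>Both indicators are at most 1, so the subtraction of natural numbers is
      exact.\<close>
    hence "4 = (4 - 2 * \<alpha> - 2 * \<beta>) + (\<alpha> * 2 + \<beta> * 2)" by simp
    hence "y ^ 4 = y ^ (4 - 2 * \<alpha> - 2 * \<beta>) * ((y ^ \<alpha>) ^ 2 * (y ^ \<beta>) ^ 2)"
      by (metis power_add power_mult)
    hence y4: "y ^ 4 / ((y ^ \<alpha>) ^ 2 * (y ^ \<beta>) ^ 2) = y ^ (4 - 2 * \<alpha> - 2 * \<beta>)"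
      using y by simp
    have "sterm z k = qint z (4 * k + 1) * T z * (y ^ 4 / ((y ^ \<alpha>) ^ 2 * (y ^ \<beta>) ^ 2))"
    proof -
      have "Q * (R * y) ^ 4 * (t / ((z * (a * Y)) * (b * Y'))) ^ 2 * Z =
          Q * (R ^ 4 * (t / (z * a * b)) ^ 2 * Z) * (y ^ 4 / (Y ^ 2 * Y' ^ 2))"
        for Q R t a b Y Y' Z :: complex
        by (simp add: power_mult_distrib power_divide mult_ac)
      moreover have "z \<noteq> 0" "z \<noteq> z ^ (2 * k)" "z ^ 2 \<noteq> 1" using elim by auto
      ultimately show ?thesis
        unfolding T_def by (simp only: sterm_qratio[of z k] q 1 2 not_False_eq_True)
    qed
    thus ?case unfolding y4 by (simp add: y_def)
  qed
  from Lim_transform_eventually[OF lim this]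
  have "((\<lambda>z. sterm z k) \<longlongrightarrow>
      (qint w (4 * k + 1) * (1 - w ^ d) ^ (4 - 2 * \<alpha> - 2 * \<beta>)) * T w) (at w)"
    by (simp only: mult.commute[of _ "T w"] mult.assoc)
  thus ?thesis unfolding zero by simp
qed

text \<open>Here zeros and poles of \<open>qratio\<close> balance. At \<open>w\<close> all other
  factors depend only on \<open>r\<close>, and the last \<open>r\<close> factors of
  \<open>unit_ratio\<close> form \<open>qratio r w\<close>.\<close>

lemma tendsto_sterm_small:
  assumes r: "r \<le> h"
  shows "((\<lambda>z. sterm z (d * m + r)) \<longlongrightarrow> unit_ratio (d * m) w ^ 4 * sterm w r) (at w)"
proof -
  define k where "k = d * m + r"
  have "d \<noteq> 0" "r < d" "r + h < d" using r d by simp_all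
  hence kd: "k div d = m" "(k + h) div d = m" by (simp_all add: k_def add.assoc)
  have wk: "w ^ (a * k + b) = w ^ (a * r + b)" for a b
    by (simp add: k_def power_add power_mult distrib_left mult.left_commute[of a] wd)
  have nd: "\<not> d dvd 2 * i + 1" "\<not> d dvd 2 * i + 2" if "i < h" for i
    using that d by (auto dest: dvd_imp_le simp: dvd_odd dvd_even simp del: mult_Suc_right)
  have nd2: "w ^ (2 * r + 2) \<noteq> 1"
    using r h d unfolding w_power_eq_1 dvd_even by (auto dest: dvd_imp_le)
  have wr: "w \<noteq> w ^ (2 * r)"
  proof (cases r)
    case 0
    thus ?thesis using prim[of 1] d h by simp
  next
    case (Suc r')
    hence "w ^ (2 * r) = w * w ^ (2 * r' + 1)" by simp
    thus ?thesis using nd(1)[of r'] w_power_eq_1[of "2 * r' + 1"] r Suc w_neq_0 by simp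
  qed
  have "unit_ratio k w = unit_ratio (d * m) w * qratio r w"
  proof -
    have dd: "d dvd 2 * (d * m + i) + b \<longleftrightarrow> d dvd 2 * i + b" for i b
    proof -
      have "2 * (d * m + i) + b = d * (2 * m) + (2 * i + b)" by (simp add: algebra_simps)
      thus ?thesis by (simp only: dvd_add_right_iff[OF dvd_triv_left])
    qed
    have ww: "w ^ (2 * (d * m + i) + b) = w ^ (2 * i + b)" for i b
      by (simp add: power_add power_mult distrib_left mult.left_commute[of 2] wd)
    have "unit_ratio (d * m + r) w = unit_ratio (d * m) w *
       (\<Prod>i<r. unit_part (2 * (d * m + i) + 1) w / unit_part (2 * (d * m + i) + 2) w)"
      by (induction r) (simp_all add: unit_ratio_def)
    also have "(\<Prod>i<r. unit_part (2 * (d * m + i) + 1) w / unit_part (2 * (d * m + i) + 2) w) = qratio r w"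
      unfolding qratio_def
    proof (intro prod.cong refl)
      fix i assume "i \<in> {..<r}"
      hence "i < h" using r by simp
      thus "unit_part (2 * (d * m + i) + 1) w / unit_part (2 * (d * m + i) + 2) w =
          (1 - w ^ (2 * i + 1)) / (1 - w ^ (2 * i + 2))"
        using nd[of i] by (simp only: unit_part_def dd ww if_False)
    qed
    finally show ?thesis by (simp only: k_def)
  qed
  moreover define T where "T z = qint z (4 * k + 1) * unit_ratio k z ^ 4 *
    ((z - 1) * (1 - z ^ 2) / ((z - z ^ (2 * k)) * (1 - z ^ (2 * k + 2)))) ^ 2 * z ^ (4 * k)" for z
  have w2k: "w ^ (2 * k) = w ^ (2 * r)" "w ^ (4 * k) = w ^ (4 * r)" using wk[of _ 0] by simp_all
  have qk: "qint w (4 * k + 1) = qint w (4 * r + 1)"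
  proof -
    have "(1 - w) * qint w (4 * k + 1) = (1 - w) * qint w (4 * r + 1)"
      unfolding qint_geometric wk ..
    thus ?thesis using prim[of 1] d h by simp
  qed
  ultimately have Tw: "T w = unit_ratio (d * m) w ^ 4 * sterm w r"
    unfolding sterm_qratio[OF w_neq_0 wr w_square_neq_1] T_def wk w2k qk
    by (simp only: power_mult_distrib mult_ac)
  have "isCont T w"
    unfolding T_def [abs_def] qint_def using wr nd2 w2k wk[of 2 2]
    by (intro continuous_intros isCont_unit_ratio) auto
  hence lim: "(T \<longlongrightarrow> T w) (at w)" by (simp add: isCont_def)
  have "\<forall>\<^sub>F z in at w. T z = sterm z k"
    using eventually_generic[of k]
  proof eventually_elim
    case (elim z)
    hence "qratio k z = unit_ratio k z"
      using qratio_unit_ratio[of z k] unfolding kd by simp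
    thus ?case using elim by (simp add: sterm_qratio T_def)
  qed
  from Lim_transform_eventually[OF lim this] show ?thesis by (simp only: Tw k_def)
qed

text \<open>The case \<open>n = d\<close>, \<open>s = 0\<close> of \<open>vsum_half_eq_0\<close>;
  its denominators do not vanish at \<open>w\<close>.\<close>

lemma sum_sterm_half: "(\<Sum>r\<le>h. sterm w r) = 0"
proof -
  have "vden w d 0 j \<noteq> 0" if "j < h" for j
  proof -
    have "\<not> d dvd 2 * j + 2" "\<not> d dvd 2 * Suc j + 2"
      unfolding dvd_even using that d by (auto dest: dvd_imp_le)
    moreover have "2 * Suc j + 2 = 2 * j + 4" by simp
    ultimately have "w ^ (2 * j + 2) \<noteq> 1" "w ^ (2 * j + 4) \<noteq> 1"
      unfolding w_power_eq_1 by metis+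
    thus ?thesis by (simp add: vden_def w_neq_0)
  qed
  hence nz: "(\<Prod>j<h. vden w d 0 j) \<noteq> 0" by simp
  have "w \<noteq> 1" using prim[of 1] d h by simp
  with sum_sterm_eq_vsum[OF w_neq_0 nz] vsum_half_eq_0[OF wd d] nz show ?thesis by simp
qed

text \<open>The range consists of \<open>e\<close> full blocks and an initial segment of length
  \<open>h + 2\<close>; the upper limit is \<open>(n + 1) / 2\<close> for
  \<open>n = d * (2 * e + 1)\<close>.\<close>

lemma tendsto_sum_sterm:
  "((\<lambda>z. \<Sum>k\<le>d * e + Suc h. sterm z k) \<longlongrightarrow> 0) (at w)"
proof -
  define l where "l k = (if k mod d \<le> h then unit_ratio (d * (k div d)) w ^ 4 * sterm w (k mod d) else 0)" for k
  have lim: "((\<lambda>z. sterm z k) \<longlongrightarrow> l k) (at w)" for k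
    using tendsto_sterm_small[of "k mod d" "k div d"] tendsto_sterm_large[of k]
    by (cases "k mod d \<le> h") (auto simp: l_def)
  \<comment> \<open>Limits beyond \<open>r = h\<close> are zero, so any \<open>b\<close> from
    \<open>h + 1\<close> to \<open>d\<close> gives the half sum. This serves both
    \<open>b = d\<close> and \<open>b = h + 2\<close>.\<close>
  have block: "(\<Sum>r<b. l (d * m + r)) = 0" if "b > h" "b \<le> d" for m b
  proof -
    have "(\<Sum>r<b. l (d * m + r)) = (\<Sum>r\<le>h. l (d * m + r))"
      using that by (intro sum.mono_neutral_right) (auto simp: l_def)
    also have "\<dots> = unit_ratio (d * m) w ^ 4 * (\<Sum>r\<le>h. sterm w r)"
      unfolding sum_distrib_left
    proof (intro sum.cong refl)
      fix r assume "r \<in> {..h}"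
      hence "r \<le> h" "r < d" "d \<noteq> 0" using d by simp_all
      thus "l (d * m + r) = unit_ratio (d * m) w ^ 4 * sterm w r" by (simp add: l_def)
    qed
    finally show ?thesis by (simp add: sum_sterm_half)
  qed
  have "sum l {..<d * e} = 0"
  proof (induction e)
    case (Suc e)
    have "d * Suc e = d * e + d" by simp
    thus ?case using Suc block[of d e] d by (simp only: sum_lessThan_add) simp
  qed simp
  moreover have "{..d * e + Suc h} = {..<d * e + Suc (Suc h)}" by auto
  ultimately have "(\<Sum>k\<le>d * e + Suc h. l k) = 0"
    using block[of "Suc (Suc h)" e] d h by (simp only: sum_lessThan_add) simp
  thus ?thesis using tendsto_sum[of "{..d * e + Suc h}" "\<lambda>k z. sterm z k" l, OF lim] by simp
qed

end

section \<open>The modulus as a product of linear factors\<close>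

lemma cpoly_qint: "cpoly (qint [:0, 1:] n) = qint [:0, 1:] n"
proof -
  have "cpoly ([:0, 1:] ^ k) = [:0, 1:] ^ k" for k
    by (induction k) (simp_all only: power_0 power_Suc map_poly_of_int_mult, simp_all add: map_poly_pCons)
  thus ?thesis
    by (induction n) (simp_all add: qint_def map_poly_of_int_add)
qed

lemma qint_eq_prod_roots:
  assumes "n > 0"
  shows "qint [:0, 1:] n = (\<Prod>z\<in>{z. z ^ n = 1} - {1}. [:- z, 1:] :: complex poly)"
proof -
  have fin: "finite {z :: complex. z ^ n = 1}" using assms by (intro finite_roots_unity) simp
  have "(1 - [:0, 1:]) * qint [:0, 1:] n = 1 - (monom 1 n :: complex poly)"
    unfolding qint_geometric by (simp add: monom_altdef)
  also have "\<dots> = - (\<Prod>z\<in>{z. z ^ n = 1}. [:- z, 1:])"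
    unfolding unity_poly_eq_prod_linear[OF assms, symmetric] by simp
  also have "(\<Prod>z\<in>{z :: complex. z ^ n = 1}. [:- z, 1:]) =
      [:- 1, 1:] * (\<Prod>z\<in>{z. z ^ n = 1} - {1}. [:- z, 1:])"
    using fin by (intro prod.remove) auto
  also have "- \<dots> = (1 - [:0, 1:]) * (\<Prod>z\<in>{z. z ^ n = 1} - {1}. [:- z, 1:])"
    by (simp add: one_pCons flip: mult_minus_left)
  finally have "(1 - [:0, 1:]) * qint [:0, 1:] n =
      (1 - [:0, 1:]) * (\<Prod>z\<in>{z :: complex. z ^ n = 1} - {1}. [:- z, 1:])" .
  moreover have "1 - [:0, 1:] \<noteq> (0 :: complex poly)" by (simp add: one_pCons)
  ultimately show ?thesis by (metis mult_left_cancel)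
qed

text \<open>\<open>[n]\<close> has a simple zero at every \<open>n\<close>-th root of unity except
  1, and the squared cyclotomic polynomial adds two at the primitive ones.\<close>

lemma cpoly_modulus:
  assumes "n > 1"
  shows "cpoly (qint [:0, 1:] n * cyclotomic n ^ 2) =
    (\<Prod>z\<in>{z. z ^ n = 1} - {1}. [:- z, 1:] ^ (if z \<in> primitive_roots_unity n then 3 else 1))"
proof -
  let ?A = "{z :: complex. z ^ n = 1} - {1}" and ?B = "primitive_roots_unity n"
  have fin: "finite ?A" using assms by (intro finite_Diff finite_roots_unity) simp
  have sub: "?B \<subseteq> ?A" using assms by (auto simp: primitive_roots_unity_def)
  have "cpoly (qint [:0, 1:] n * cyclotomic n ^ 2) =
      (\<Prod>z\<in>?A. [:- z, 1:]) * (\<Prod>z\<in>?B. [:- z, 1:] ^ 2)"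
  proof -
    have "cpoly (qint [:0, 1:] n * cyclotomic n ^ 2) = qint [:0, 1:] n * cpoly (cyclotomic n) ^ 2"
      by (simp only: power2_eq_square map_poly_of_int_mult cpoly_qint)
    also have "cpoly (cyclotomic n) ^ 2 = (\<Prod>z\<in>?B. [:- z, 1:] ^ 2)"
      using assms by (simp only: of_int_poly_cyclotomic complex_cyclotomic_def prod_power_distrib)
    also have "qint [:0, 1:] n = (\<Prod>z\<in>?A. [:- z, 1:])"
      using assms by (intro qint_eq_prod_roots) simp
    finally show ?thesis .
  qed
  also have "(\<Prod>z\<in>?B. [:- z, 1:] ^ 2) = (\<Prod>z\<in>?A. [:- z, 1:] ^ (if z \<in> ?B then 2 else 0))"
    using fin sub by (intro prod.mono_neutral_cong_left) auto
  also have "(\<Prod>z\<in>?A. [:- z, 1:]) * \<dots> =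
      (\<Prod>z\<in>?A. [:- z, 1:] ^ (if z \<in> ?B then 3 else 1))"
  proof -
    have "x * x ^ (if b then 2 else 0) = x ^ (if b then 3 else 1)" for b and x :: "complex poly"
      by (simp add: eval_nat_numeral)
    thus ?thesis by (simp only: prod.distrib [symmetric])
  qed
  finally show ?thesis .
qed

lemma lead_coeff_modulus:
  assumes "n > 1"
  shows "lead_coeff (qint [:0, 1:] n * cyclotomic n ^ 2 :: int poly) = 1"
proof -
  let ?P = "qint [:0, 1:] n * cyclotomic n ^ 2 :: int poly"
  have "lead_coeff (cpoly ?P) = 1"
    unfolding cpoly_modulus[OF assms] lead_coeff_prod by (simp add: lead_coeff_power)
  thus ?thesis by (simp add: degree_map_poly_of_int coeff_map_poly)
qed

section \<open>Zeros of the reduced numerator\<close>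

lemma primitive_root_power_eq_1:
  assumes "w \<in> primitive_roots_unity n" "0 < i" "i < n"
  shows "w ^ i \<noteq> 1"
  using assms by (auto simp: primitive_roots_unity_def)

text \<open>Clearing the common denominator \<open>D\<close> gives the polynomial identity
  \<open>p * D = V * r\<close>. Since \<open>D\<close> does not vanish at \<open>w\<close>, the
  triple zero of \<open>V\<close> is one of \<open>p\<close>.\<close>

lemma cube_dvd_numerator:
  assumes w: "w \<in> primitive_roots_unity n" and n: "n = 2 * m + 1" "m > 1"
    and pr: "\<forall>\<^sub>F z in cofinite. poly p z = (\<Sum>k\<le>Suc m. sterm z k) * poly r z"
  shows "[:-w, 1:] ^ 3 dvd p"
proof -
  define D where "D = (\<Prod>j<Suc m. vden [:0, 1:] n 0 j :: complex poly)"
  define V :: "complex poly" where "V = vsum [:0, 1:] n 0 (Suc m)"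
  have wn: "w ^ n = 1" using w by (simp add: primitive_roots_unity_def)
  have prim: "w ^ i \<noteq> 1" if "0 < i" "i < n" for i
    using primitive_root_power_eq_1[OF w that] .
  have D_poly: "poly D z = (\<Prod>j<Suc m. vden z n 0 j)" for z
    by (simp add: D_def poly_prod vden_def)
  have V_poly: "poly V z = vsum z n 0 (Suc m)" for z
    by (simp add: V_def poly_vsum)
  have Dw: "poly D w \<noteq> 0"
  proof -
    \<comment> \<open>Otherwise \<open>2 * l - n\<close> would be an exponent strictly between
      \<open>0\<close> and \<open>n\<close>, as \<open>n\<close> is odd. The bound
      \<open>l < n\<close> follows from \<open>l \<le> m + 2\<close> because
      \<open>m > 1\<close>.\<close>
    have "w ^ (2 * l) \<noteq> 1" if "0 < l" "l \<le> m + 2" "l < n" for l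
    proof
      assume 1: "w ^ (2 * l) = 1"
      have "n \<le> 2 * l" using prim[of "2 * l"] 1 that by force
      moreover have "n \<noteq> 2 * l" using n by presburger
      ultimately have "w ^ (2 * l - n) * w ^ n = 1"
        using 1 by (simp flip: power_add)
      moreover have "2 * l - n < n" "0 < 2 * l - n" using that \<open>n \<le> 2 * l\<close> \<open>n \<noteq> 2 * l\<close> by auto
      ultimately show False using prim[of "2 * l - n"] wn by simp
    qed
    from this[of "Suc _"] this[of "Suc (Suc _)"] have
      "w ^ (2 * j + 2) \<noteq> 1" "w ^ (2 * j + 4) \<noteq> 1" if "j < Suc m" for j
      using that n by (simp_all add: numeral_eq_Suc)
    moreover have "w \<noteq> 0" using wn n by (auto simp: power_0_left)
    ultimately show ?thesis unfolding D_poly by (auto simp: vden_def)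
  qed
  hence "D \<noteq> 0" by auto
  have "p * D = V * r"
  proof (rule poly_eqI_cofinite)
    have "\<forall>\<^sub>F z :: complex in cofinite. z \<noteq> 0" by (simp add: eventually_cofinite)
    with pr eventually_poly_neq_0[OF \<open>D \<noteq> 0\<close>]
    show "\<forall>\<^sub>F z in cofinite. poly (p * D) z = poly (V * r) z"
    proof eventually_elim
      case (elim z)
      thus ?case using sum_sterm_eq_vsum[where z = z and N = "Suc m" and n = n] 
        by (simp add: D_poly V_poly mult_ac del: sum.atMost_Suc prod.lessThan_Suc)
    qed
  qed
  moreover have "[:-w, 1:] ^ 3 dvd V"
    unfolding V_def using prim[of 1] n wn by (intro cube_dvd_vsum vsum_special_eq_0) auto
  ultimately have "[:-w, 1:] ^ 3 dvd p * D" by simp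
  thus ?thesis using Dw by (rule linear_power_dvd_cancel)
qed

text \<open>With \<open>d\<close> the order of \<open>w\<close>, the sum tends to zero at
  \<open>w\<close>, and the continuous function \<open>p\<close> agrees with the sum times
  \<open>r\<close> near \<open>w\<close>.\<close>

lemma root_numerator:
  assumes w: "w ^ n = 1" "w \<noteq> 1" and n: "n = 2 * m + 1"
    and pr: "\<forall>\<^sub>F z in cofinite. poly p z = (\<Sum>k\<le>Suc m. sterm z k) * poly r z"
  shows "poly p w = 0"
proof -
  obtain d where d: "d dvd n" "w \<in> primitive_roots_unity d"
    using roots_unity_partition[of n] w n by auto
  have "odd d" using dvd_trans[of 2 d n] d(1) n by auto
  then obtain h where h: "d = 2 * h + 1" by (auto elim: oddE)
  have "h \<noteq> 0"
  proof
    assume "h = 0"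
    thus False using d(2) w h by (simp add: primitive_roots_unity_def)
  qed
  obtain f where f: "n = d * f" using d(1) by (auto elim: dvdE)
  have "odd f" using f n by (metis even_mult_iff even_plus_one_iff dvd_triv_left)
  then obtain e where "f = 2 * e + 1" by (auto elim: oddE)
  \<comment> \<open>Since \<open>d\<close> and \<open>n / d\<close> are both odd, the upper limit of
    the sum takes the form required by \<open>tendsto_sum_sterm\<close>.\<close>
  hence m: "Suc m = d * e + Suc h" using f n h by (simp add: algebra_simps)
  have "((\<lambda>z. \<Sum>k\<le>Suc m. sterm z k) \<longlongrightarrow> 0) (at w)"
    unfolding m using h \<open>h \<noteq> 0\<close> d(2)
    by (intro tendsto_sum_sterm primitive_root_power_eq_1[of w d])
      (auto simp: primitive_roots_unity_def)
  moreover have "(poly r \<longlongrightarrow> poly r w) (at w)"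
    by (simp flip: isCont_def)
  ultimately have "((\<lambda>z. (\<Sum>k\<le>Suc m. sterm z k) * poly r z) \<longlongrightarrow> 0 * poly r w) (at w)"
    by (rule tendsto_mult)
  moreover have "\<forall>\<^sub>F z in at w. (\<Sum>k\<le>Suc m. sterm z k) * poly r z = poly p z"
    using eventually_at_if_cofinite[OF pr, of w] by eventually_elim simp
  ultimately have "(poly p \<longlongrightarrow> 0) (at w)"
    by (metis Lim_transform_eventually mult_zero_left)
  moreover have "(poly p \<longlongrightarrow> poly p w) (at w)"
    by (simp flip: isCont_def)
  ultimately show ?thesis using tendsto_unique[OF at_neq_bot] by blast
qed

theorem theorem5p5:
  fixes n :: nat
  assumes "n > 3" and "odd n"
  shows "ratfun_cong
    (\<Sum>k=0..(n + 1) div 2.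
        qint qvar (4 * k + 1) *
        ((qpoch (inverse qvar) (qvar ^ 2) k) ^ 2 * (qpoch qvar (qvar ^ 2) k) ^ 2 /
         ((qpoch (qvar ^ 4) (qvar ^ 2) k) ^ 2 * (qpoch (qvar ^ 2) (qvar ^ 2) k) ^ 2)) *
        qvar ^ (4 * k))
    0
    (qint [:0, 1:] n * cyclotomic n ^ 2)"
    (is "ratfun_cong ?x 0 ?P")
proof -
  obtain m where n: "n = 2 * m + 1" using assms(2) by (auto elim: oddE)
  have m: "m > 1" using assms(1) n by simp
  define p r where "p = fst (quot_of_fract ?x)" and "r = snd (quot_of_fract ?x)"
  have "{0..(n + 1) div 2} = {..Suc m}" using n by auto
  moreover have "represents ?x (\<lambda>z. \<Sum>k=0..(n + 1) div 2. sterm z k)"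
    unfolding sterm_def
    by (intro represents_sum represents_mult represents_divide represents_power represents_qint
        represents_qpoch represents_inverse represents_qvar)
  ultimately have pr: "\<forall>\<^sub>F z in cofinite.
      poly (cpoly p) z = (\<Sum>k\<le>Suc m. sterm z k) * poly (cpoly r) z"
    unfolding p_def r_def using represents_quot_of_fract by fastforce
  have fin: "finite ({z :: complex. z ^ n = 1} - {1})"
    using n by (intro finite_Diff finite_roots_unity) simp
  have "cpoly ?P dvd cpoly p"
    unfolding cpoly_modulus[OF order.strict_trans[OF _ assms(1)], simplified]
  proof (rule prod_linear_power_dvd[OF fin])
    fix z :: complex assume "z \<in> {z. z ^ n = 1} - {1}"
    hence "poly (cpoly p) z = 0" using root_numerator[OF _ _ n pr] by simp
    thus "[:- z, 1:] ^ (if z \<in> primitive_roots_unity n then 3 else 1) dvd cpoly p"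
      using cube_dvd_numerator[OF _ n m pr, of z] by (simp add: poly_eq_0_iff_dvd)
  qed
  hence "?P dvd p"
    using lead_coeff_modulus[of n] assms(1) by (intro monic_dvd_if_cpoly_dvd) auto
  thus ?thesis by (simp add: ratfun_cong_def p_def)
qed

end
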